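(* Let $R$ be a commutative ring containing $\mathbb{Q}$, let $\mathfrak g$ be a Lie algebra over $R$, free of finite rank as an $R$-module, with non-degenerate classical $r$-matrix $r$. Fix a symplectic torsion-free covariant derivative $\nabla$ on $\mathfrak g$, an element $s\in\mathrm S^2\mathfrak g$ with $\nabla_Xs=0$ for all $X\in\mathfrak g$, and a $\delta_{CE}$-closed $\Omega\in t\Lambda^2\mathfrak g^*[[t]]$. Let $\mathcal A$ be an associative $R$-algebra with multiplication $\mu_{\mathcal A}$ and an action $\triangleright$ of $\mathfrak g$ by derivations. Let $\star_{\Omega,\nabla,s}$ be the Fedosov star product on $\mathcal A[[t]]$, and let $\mathcal F_{\Omega,\nabla,s}=1\star1\in(\mathscr U(\mathfrak g)\otimes\mathscr U(\mathfrak g))[[t]]$ be the Fedosov twist obtained from the Fedosov star product for the same data on the tensor algebra $\mathrm T^\bullet(\mathscr U(\mathfrak g))[[t]]$. Then for all $a,b\in\mathcal A$ $$a\star_{\Omega,\nabla,s}b=a\star_{\mathcal F_{\Omega,\nabla,s}}b,\qquad\text{where } a\star_{\mathcal F}b=\mu_{\mathcal A}(\mathcal F\triangleright(a\otimes b)).$$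
   Context: The action of $\mathfrak g$ on $\mathcal A$ is extended to an action $\triangleright$ of $\mathscr U(\mathfrak g)$, then of $\mathscr U(\mathfrak g)\otimes\mathscr U(\mathfrak g)$ on $\mathcal A\otimes\mathcal A$, and $R[[t]]$-linearly to formal power series. Setting. $e_1,\dots,e_n$ is a basis of $\mathfrak g$, $e^1,\dots,e^n$ the dual basis; summation convention is used. $r=r^{ij}e_i\otimes e_j$ (antisymmetric) is a classical $r$-matrix if $[[r,r]]=0$ for the extension of the Lie bracket to a Gerstenhaber bracket on $\Lambda^\bullet\mathfrak g$; non-degenerate means the matrix $(r^{ij})$ is invertible over $R$. $\omega=\frac12\omega_{ij}e^i\wedge e^j$ with $r^{ij}\omega_{jk}=\delta^i_k$ is the inverse of $r$. $\delta_{CE}$ is the Chevalley-Eilenberg differential on $\Lambda^\bullet\mathfrak g^*$ (trivial coefficients). Covariant derivative: a bilinear map $\nabla:\mathfrak g\times\mathfrak g\to\mathfrak g$; torsion-free: $\nabla_XY-\nabla_YX=[X,Y]$. $\nabla_X$ is extended to $\mathfrak g^*$ by $(\nabla_X\alpha)(Y)=-\alpha(\nabla_XY)$ and to all tensors as a derivation; symplectic: $\nabla_X\omega=0$ for all $X$. Curvature: $\tilde R(X,Y)=\nabla_X\nabla_Y-\nabla_Y\nabla_X-\nabla_{[X,Y]}$, and $\mathsf R=\frac14\omega(e_k,\tilde R(e_i,e_j)e_l)\,e^k\vee e^l\otimes e^i\wedge e^j\in \mathrm S^2\mathfrak g^*\otimes\Lambda^2\mathfrak g^*$. Formal Weyl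 algebra: $\mathcal W\otimes\Lambda^\bullet=\bigl(\prod_{k\ge0}\mathrm S^k\mathfrak g^*\otimes\Lambda^\bullet\mathfrak g^*\bigr)[[t]]$ with product $\mu$: $(f\otimes\alpha)(g\otimes\beta)=f\vee g\otimes\alpha\wedge\beta$. Total degree of $t^m\,\mathrm S^k\mathfrak g^*\otimes\Lambda^\ell\mathfrak g^*$ is $k+2m$; $\mathcal W_k\otimes\Lambda^\ell$ denotes elements of antisymmetric degree $\ell$ all of whose homogeneous components have total degree $\ge k$. $i_s(X)$, $i_a(X)$ are the symmetric and antisymmetric insertion derivations. $\delta=e^i\wedge i_s(e_i)$; $\delta^{-1}=\frac1{k+\ell}\,e^i\vee i_a(e_i)$ on $\mathrm S^k\mathfrak g^*\otimes\Lambda^\ell\mathfrak g^*$ if $k+\ell>0$ and $\delta^{-1}=0$ if $k=\ell=0$; $\sigma$ is the projection onto symmetric and antisymmetric degree $0$. With $\pi=r+s$, $\pi^{ij}=r^{ij}+s^{ij}$, $a\circ_\pi b=\mu\circ e^{\frac t2\mathcal P}(a\otimes b)$, $\mathcal P=\pi^{ij}i_s(e_i)\otimes i_s(e_j)$; $\mathrm{ad}(a)b=[a,b]$ is the graded $\circ_\pi$-commutator w.r.t. the antisymmetric degree. $D(f\otimes\alpha)=\nabla_{e_i}f\otimes e^i\wedge\alpha+f\otimes\delta_{CE}\alpha$. Given $\Omega$, there is a unique $\varrho\in\mathcal W_2\otimes\Lambda^1$ with $\delta\varrho=\mathsf R+D\varrho+\frac1t\varrho\circ_\pi\varrho+\Omega$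 and $\delta^{-1}\varrho=0$. Fedosov star product for an algebra $\mathcal A$ with $\mathfrak g$-action by derivations: on $\mathcal A\otimes\mathcal W\otimes\Lambda^\bullet=\prod_k(\mathcal A\otimes \mathrm S^k\mathfrak g^*\otimes\Lambda^\bullet\mathfrak g^* )[[t]]$ (operators above acting on the last two factors) put $m^{\mathcal A}_\pi(\xi_1\otimes a_1,\xi_2\otimes a_2)=(\xi_1\cdot\xi_2)\otimes(a_1\circ_\pi a_2)$, $L_{\mathcal A}(\xi\otimes f\otimes\alpha)=e_i\triangleright\xi\otimes f\otimes e^i\wedge\alpha$, $\tau_{\mathcal A}(\xi)=\sum_{k\ge0}[\delta^{-1},D+L_{\mathcal A}+\frac1t\mathrm{ad}(\varrho)]^k(\xi)$ for $\xi\in\mathcal A[[t]]$ (supercommutator w.r.t. antisymmetric degree, here an anticommutator), and $\xi\star_{\Omega,\nabla,s}\eta=\sigma(m^{\mathcal A}_\pi(\tau_{\mathcal A}(\xi),\tau_{\mathcal A}(\eta)))$. Fedosov twist: the special case where the algebra is the tensor algebra $\mathrm T^\bullet(\mathscr U(\mathfrak g))$ over $R$ of the $R$-module $\mathscr U(\mathfrak g)$ with product $\otimes$, and $X\in\mathfrak g$ acts by left multiplication by $X$ on $\mathscr U(\mathfrak g)$ extended as a derivation of $\otimes$; $\mathcal F_{\Omega,\nabla,s}=1\star1$ with $1\in\mathscr U(\mathfrak g)$ the unit of the enveloping algebra. *)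

theory Defs
  imports
    "HOL-Algebra.Algebraic_Closure_Type"
    "HOL-Algebra.QuotRing"
    "HOL-Library.Poly_Mapping"
    "HOL-Library.Multiset"
begin

section \<open>Modules, algebras and Lie algebras\<close>

text \<open>
  The ground ring is a type \<open>'r :: comm_ring_1\<close>. Everything else is carrier-based,
  because the enveloping algebra and the tensor algebra below are quotients that depend on
  the Lie bracket, hence not types.
\<close>

abbreviation ground :: "'r::comm_ring_1 ring" where
  "ground \<equiv> ring_of_type_algebra"

definition contains_rat :: "(rat \<Rightarrow> 'r::comm_ring_1) \<Rightarrow> bool" where
  "contains_rat \<iota> \<longleftrightarrow> inj \<iota> \<and> \<iota> 1 = 1 \<and>
     (\<forall>x y. \<iota> (x + y) = \<iota> x + \<iota> y) \<and> (\<forall>x y. \<iota> (x * y) = \<iota> x * \<iota> y)"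

definition bilinear_map ::
  "('r::comm_ring_1, 'a) module \<Rightarrow> ('r, 'b) module \<Rightarrow> ('r, 'c) module \<Rightarrow> ('a \<Rightarrow> 'b \<Rightarrow> 'c) \<Rightarrow> bool" where
  "bilinear_map M N P f \<longleftrightarrow>
     (\<forall>x\<in>carrier M. \<forall>y\<in>carrier N. f x y \<in> carrier P) \<and>
     (\<forall>x\<in>carrier M. \<forall>x'\<in>carrier M. \<forall>y\<in>carrier N. f (x \<oplus>\<^bsub>M\<^esub> x') y = f x y \<oplus>\<^bsub>P\<^esub> f x' y) \<and>
     (\<forall>x\<in>carrier M. \<forall>y\<in>carrier N. \<forall>y'\<in>carrier N. f x (y \<oplus>\<^bsub>N\<^esub> y') = f x y \<oplus>\<^bsub>P\<^esub> f x y') \<and>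
     (\<forall>c. \<forall>x\<in>carrier M. \<forall>y\<in>carrier N. f (c \<odot>\<^bsub>M\<^esub> x) y = c \<odot>\<^bsub>P\<^esub> f x y) \<and>
     (\<forall>c. \<forall>x\<in>carrier M. \<forall>y\<in>carrier N. f x (c \<odot>\<^bsub>N\<^esub> y) = c \<odot>\<^bsub>P\<^esub> f x y)"

text \<open>
  In the module record of a Lie algebra the fields \<open>mult\<close> and \<open>one\<close> are unused; the
  bracket is a separate parameter.
\<close>

definition lie_algebra :: "('r::comm_ring_1, 'g) module \<Rightarrow> ('g \<Rightarrow> 'g \<Rightarrow> 'g) \<Rightarrow> bool" where
  "lie_algebra G br \<longleftrightarrow> module ground G \<and> bilinear_map G G G br \<and>
     (\<forall>x\<in>carrier G. br x x = \<zero>\<^bsub>G\<^esub>) \<and>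
     (\<forall>x\<in>carrier G. \<forall>y\<in>carrier G. \<forall>z\<in>carrier G.
        br x (br y z) \<oplus>\<^bsub>G\<^esub> br y (br z x) \<oplus>\<^bsub>G\<^esub> br z (br x y) = \<zero>\<^bsub>G\<^esub>)"

text \<open>Algebras are not required to have a unit; the field \<open>one\<close> is ignored.\<close>

definition assoc_algebra :: "('r::comm_ring_1, 'a) module \<Rightarrow> bool" where
  "assoc_algebra A \<longleftrightarrow> module ground A \<and> bilinear_map A A A (monoid.mult A) \<and>
     (\<forall>x\<in>carrier A. \<forall>y\<in>carrier A. \<forall>z\<in>carrier A.
        (x \<otimes>\<^bsub>A\<^esub> y) \<otimes>\<^bsub>A\<^esub> z = x \<otimes>\<^bsub>A\<^esub> (y \<otimes>\<^bsub>A\<^esub> z))"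

definition acts_by_derivations ::
  "('r::comm_ring_1, 'g) module \<Rightarrow> ('g \<Rightarrow> 'g \<Rightarrow> 'g) \<Rightarrow> ('r, 'a) module \<Rightarrow> ('g \<Rightarrow> 'a \<Rightarrow> 'a) \<Rightarrow> bool" where
  "acts_by_derivations G br A act \<longleftrightarrow> bilinear_map G A A act \<and>
     (\<forall>x\<in>carrier G. \<forall>y\<in>carrier G. \<forall>a\<in>carrier A.
        act (br x y) a = act x (act y a) \<ominus>\<^bsub>A\<^esub> act y (act x a)) \<and>
     (\<forall>x\<in>carrier G. \<forall>a\<in>carrier A. \<forall>b\<in>carrier A.
        act x (a \<otimes>\<^bsub>A\<^esub> b) = (act x a \<otimes>\<^bsub>A\<^esub> b) \<oplus>\<^bsub>A\<^esub> (a \<otimes>\<^bsub>A\<^esub> act x b))"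


section \<open>Tensor algebra and universal enveloping algebra\<close>

text \<open>
  With lists as a monoid under concatenation, \<open>'m list \<Rightarrow>\<^sub>0 'r\<close> is the free associative unital
  algebra on \<open>'m\<close>.
\<close>

instantiation list :: (type) monoid_add
begin
definition zero_list :: "'a list" where "zero_list = []"
definition plus_list :: "'a list \<Rightarrow> 'a list \<Rightarrow> 'a list" where "plus_list = (@)"
instance by standard (simp_all add: zero_list_def plus_list_def)
end

definition free_algebra :: "'m set \<Rightarrow> ('r::comm_ring_1, 'm list \<Rightarrow>\<^sub>0 'r) module" where
  "free_algebra S =
     \<lparr>carrier = {p. Poly_Mapping.keys p \<subseteq> lists S}, monoid.mult = (*), one = 1, zero = 0, add = (+),
      module.smult = (\<lambda>c p. Poly_Mapping.single [] c * p)\<rparr>"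

text \<open>\<open>FactRing\<close> forgets the scalar multiplication; scaling by \<open>c\<close> is multiplication by the
  class of \<open>c \<odot> \<one>\<close>.\<close>

definition quotient_algebra :: "('r, 'a) module \<Rightarrow> 'a set \<Rightarrow> ('r, 'a set) module" where
  "quotient_algebra F J =
     \<lparr>carrier = carrier (F Quot J), monoid.mult = monoid.mult (F Quot J), one = monoid.one (F Quot J),
      zero = ring.zero (F Quot J), add = ring.add (F Quot J),
      module.smult = (\<lambda>c x. (J +>\<^bsub>F\<^esub> (c \<odot>\<^bsub>F\<^esub> \<one>\<^bsub>F\<^esub>)) \<otimes>\<^bsub>F Quot J\<^esub> x)\<rparr>"

definition tensor_ideal :: "('r::comm_ring_1, 'm) module \<Rightarrow> ('m list \<Rightarrow>\<^sub>0 'r) set" where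
  "tensor_ideal M = genideal (free_algebra (carrier M))
     ({Poly_Mapping.single [x \<oplus>\<^bsub>M\<^esub> y] 1 - Poly_Mapping.single [x] 1 - Poly_Mapping.single [y] 1
         | x y. x \<in> carrier M \<and> y \<in> carrier M} \<union>
      {Poly_Mapping.single [c \<odot>\<^bsub>M\<^esub> x] 1 - Poly_Mapping.single [x] c | c x. x \<in> carrier M})"

definition tensor_algebra ::
  "('r::comm_ring_1, 'm) module \<Rightarrow> ('r, ('m list \<Rightarrow>\<^sub>0 'r) set) module" where
  "tensor_algebra M = quotient_algebra (free_algebra (carrier M)) (tensor_ideal M)"

text \<open>\<open>tensor M [x\<^sub>1, \<dots>, x\<^sub>k]\<close> is \<open>x\<^sub>1 \<otimes> \<dots> \<otimes> x\<^sub>k\<close>.\<close>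

definition tensor :: "('r::comm_ring_1, 'm) module \<Rightarrow> 'm list \<Rightarrow> ('m list \<Rightarrow>\<^sub>0 'r) set" where
  "tensor M w = tensor_ideal M +>\<^bsub>free_algebra (carrier M)\<^esub> Poly_Mapping.single w 1"

text \<open>
  The homogeneous part of degree \<open>k\<close>; the ideal being homogeneous, \<open>tensor_power M 2\<close> is
  the tensor product of \<open>M\<close> with itself.
\<close>

definition tensor_power :: "('r::comm_ring_1, 'm) module \<Rightarrow> nat \<Rightarrow> ('m list \<Rightarrow>\<^sub>0 'r) set set" where
  "tensor_power M k =
     {tensor_ideal M +>\<^bsub>free_algebra (carrier M)\<^esub> p | p.
        p \<in> carrier (free_algebra (carrier M)) \<and> (\<forall>w\<in>Poly_Mapping.keys p. length w = k)}"

text \<open>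
  The linear map from the tensor algebra to \<open>V\<close> with value \<open>h [x\<^sub>1, \<dots>, x\<^sub>k]\<close> on
  \<open>x\<^sub>1 \<otimes> \<dots> \<otimes> x\<^sub>k\<close>. It is independent of the representative if \<open>h\<close> is multilinear on
  the words of each length.
\<close>

definition tensor_lift ::
  "('r::comm_ring_1, 'v) module \<Rightarrow> ('m list \<Rightarrow> 'v) \<Rightarrow> ('m list \<Rightarrow>\<^sub>0 'r) set \<Rightarrow> 'v" where
  "tensor_lift V h x =
     (let p = (SOME p. p \<in> x)
      in \<Oplus>\<^bsub>V\<^esub>w\<in>Poly_Mapping.keys p. Poly_Mapping.lookup p w \<odot>\<^bsub>V\<^esub> h w)"

definition enveloping_ideal ::
  "('r::comm_ring_1, 'g) module \<Rightarrow> ('g \<Rightarrow> 'g \<Rightarrow> 'g) \<Rightarrow> ('g list \<Rightarrow>\<^sub>0 'r) set set" where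
  "enveloping_ideal G br = genideal (tensor_algebra G)
     {tensor G [x, y] \<ominus>\<^bsub>tensor_algebra G\<^esub> tensor G [y, x] \<ominus>\<^bsub>tensor_algebra G\<^esub> tensor G [br x y]
        | x y. x \<in> carrier G \<and> y \<in> carrier G}"

definition enveloping_algebra ::
  "('r::comm_ring_1, 'g) module \<Rightarrow> ('g \<Rightarrow> 'g \<Rightarrow> 'g) \<Rightarrow> ('r, ('g list \<Rightarrow>\<^sub>0 'r) set set) module" where
  "enveloping_algebra G br = quotient_algebra (tensor_algebra G) (enveloping_ideal G br)"

definition enveloping_incl ::
  "('r::comm_ring_1, 'g) module \<Rightarrow> ('g \<Rightarrow> 'g \<Rightarrow> 'g) \<Rightarrow> 'g \<Rightarrow> ('g list \<Rightarrow>\<^sub>0 'r) set set" where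
  "enveloping_incl G br x = enveloping_ideal G br +>\<^bsub>tensor_algebra G\<^esub> tensor G [x]"

text \<open>The extension of a Lie algebra action to the enveloping algebra, via representatives.\<close>

definition enveloping_act ::
  "('r::comm_ring_1, 'a) module \<Rightarrow> ('g \<Rightarrow> 'a \<Rightarrow> 'a) \<Rightarrow> ('g list \<Rightarrow>\<^sub>0 'r) set set \<Rightarrow> 'a \<Rightarrow> 'a" where
  "enveloping_act A act u a = tensor_lift A (\<lambda>w. foldr act w a) (SOME p. p \<in> u)"

text \<open>\<open>(u \<otimes> v) \<rhd> (a \<otimes> b) = (u \<rhd> a) \<otimes> (v \<rhd> b)\<close>, extended bilinearly.\<close>

definition enveloping_act2 ::
  "('r::comm_ring_1, 'a) module \<Rightarrow> ('g \<Rightarrow> 'a \<Rightarrow> 'a) \<Rightarrow>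
   (('g list \<Rightarrow>\<^sub>0 'r) set set list \<Rightarrow>\<^sub>0 'r) set \<Rightarrow> ('a list \<Rightarrow>\<^sub>0 'r) set \<Rightarrow> ('a list \<Rightarrow>\<^sub>0 'r) set" where
  "enveloping_act2 A act F Z =
     tensor_lift (tensor_algebra A)
       (\<lambda>uv. tensor_lift (tensor_algebra A)
          (\<lambda>ab. case (uv, ab) of
             ([u, v], [a, b]) \<Rightarrow> tensor A [enveloping_act A act u a, enveloping_act A act v b]
           | _ \<Rightarrow> \<zero>\<^bsub>tensor_algebra A\<^esub>) Z) F"

definition mult_map :: "('r::comm_ring_1, 'a) module \<Rightarrow> ('a list \<Rightarrow>\<^sub>0 'r) set \<Rightarrow> 'a" where
  "mult_map A Z = tensor_lift A (\<lambda>ab. case ab of [a, b] \<Rightarrow> a \<otimes>\<^bsub>A\<^esub> b | _ \<Rightarrow> \<zero>\<^bsub>A\<^esub>) Z"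

text \<open>Left multiplication on the enveloping algebra, extended as a derivation.\<close>

definition tensor_enveloping_act ::
  "('r::comm_ring_1, 'g) module \<Rightarrow> ('g \<Rightarrow> 'g \<Rightarrow> 'g) \<Rightarrow> 'g \<Rightarrow>
   (('g list \<Rightarrow>\<^sub>0 'r) set set list \<Rightarrow>\<^sub>0 'r) set \<Rightarrow> (('g list \<Rightarrow>\<^sub>0 'r) set set list \<Rightarrow>\<^sub>0 'r) set" where
  "tensor_enveloping_act G br x =
     (let U = enveloping_algebra G br
      in tensor_lift (tensor_algebra U)
           (\<lambda>w. \<Oplus>\<^bsub>tensor_algebra U\<^esub>i\<in>{..<length w}.
                  tensor U (w[i := enveloping_incl G br x \<otimes>\<^bsub>U\<^esub> w ! i])))"

text \<open>The universal deformation formula for a series \<open>F\<close> in \<open>(U \<otimes> U)[[t]]\<close>.\<close>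

definition twist_star ::
  "('r::comm_ring_1, 'a) module \<Rightarrow> ('g \<Rightarrow> 'a \<Rightarrow> 'a) \<Rightarrow>
   (nat \<Rightarrow> (('g list \<Rightarrow>\<^sub>0 'r) set set list \<Rightarrow>\<^sub>0 'r) set) \<Rightarrow> 'a \<Rightarrow> 'a \<Rightarrow> nat \<Rightarrow> 'a" where
  "twist_star A act F a b = (\<lambda>m. mult_map A (enveloping_act2 A act (F m) (tensor A [a, b])))"


section \<open>Exterior algebra in coordinates\<close>

text \<open>
  An element of the exterior algebra on a basis indexed by \<open>{..<n}\<close> is given by its
  coefficients: the set \<open>{i\<^sub>1 < \<dots> < i\<^sub>l}\<close> stands for the wedge product of the corresponding
  basis vectors in increasing order. \<open>contract i\<close> is the insertion of the \<open>i\<close>-th element of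
  the dual basis into the first argument.
\<close>

definition wedge_sign :: "nat set \<Rightarrow> nat set \<Rightarrow> 'r::comm_ring_1" where
  "wedge_sign J K = (- 1) ^ card {(j, k). j \<in> J \<and> k \<in> K \<and> k < j}"

definition wedge :: "(nat set \<Rightarrow> 'r::comm_ring_1) \<Rightarrow> (nat set \<Rightarrow> 'r) \<Rightarrow> nat set \<Rightarrow> 'r" where
  "wedge a b I = (\<Sum>J\<in>Pow I. wedge_sign J (I - J) * a J * b (I - J))"

definition contract :: "nat \<Rightarrow> (nat set \<Rightarrow> 'r::comm_ring_1) \<Rightarrow> nat set \<Rightarrow> 'r" where
  "contract i a I = (if i \<in> I then 0 else (- 1) ^ card {j \<in> I. j < i} * a (insert i I))"


section \<open>The formal Weyl algebra in coordinates\<close>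

text \<open>
  The index \<open>(m, M, I)\<close> stands for the monomial \<open>t\<^sup>m\<close> times the symmetric product of the
  \<open>e\<^sup>i\<close>, \<open>i \<in># M\<close>, tensor the exterior product of the \<open>e\<^sup>i\<close>, \<open>i \<in> I\<close>. Arbitrary functions
  supported on the monomials over \<open>{..<n}\<close> are exactly the formal series.
\<close>

type_synonym mono = "nat \<times> nat multiset \<times> nat set"

definition valid_mono :: "nat \<Rightarrow> mono \<Rightarrow> bool" where
  "valid_mono n = (\<lambda>(m, M, I). set_mset M \<subseteq> {..<n} \<and> I \<subseteq> {..<n})"

definition monom_w :: "mono \<Rightarrow> mono \<Rightarrow> 'r::comm_ring_1" where
  "monom_w Y = (\<lambda>x. if x = Y then 1 else 0)"

definition sym_gen :: "nat \<Rightarrow> mono \<Rightarrow> 'r::comm_ring_1" where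
  "sym_gen i = monom_w (0, {#i#}, {})"

definition ext_gen :: "nat \<Rightarrow> mono \<Rightarrow> 'r::comm_ring_1" where
  "ext_gen i = monom_w (0, {#}, {i})"

definition w_mult :: "(mono \<Rightarrow> 'r::comm_ring_1) \<Rightarrow> (mono \<Rightarrow> 'r) \<Rightarrow> mono \<Rightarrow> 'r" where
  "w_mult a b = (\<lambda>(m, M, I). \<Sum>k\<le>m. \<Sum>N\<in>{N. N \<subseteq># M}.
     wedge (\<lambda>J. a (k, N, J)) (\<lambda>J. b (m - k, M - N, J)) I)"

definition ins_sym :: "nat \<Rightarrow> (mono \<Rightarrow> 'r::comm_ring_1) \<Rightarrow> mono \<Rightarrow> 'r" where
  "ins_sym i a = (\<lambda>(m, M, I). of_nat (Suc (count M i)) * a (m, add_mset i M, I))"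

definition ins_ext :: "nat \<Rightarrow> (mono \<Rightarrow> 'r::comm_ring_1) \<Rightarrow> mono \<Rightarrow> 'r" where
  "ins_ext i a = (\<lambda>(m, M, I). contract i (\<lambda>J. a (m, M, J)) I)"

definition ext_part :: "nat \<Rightarrow> (mono \<Rightarrow> 'r::comm_ring_1) \<Rightarrow> mono \<Rightarrow> 'r" where
  "ext_part l a = (\<lambda>(m, M, I). if card I = l then a (m, M, I) else 0)"

text \<open>\<open>w_filtered n k l\<close> is the set \<open>W\<^sub>k \<otimes> \<Lambda>\<^sup>l\<close>.\<close>

definition w_filtered :: "nat \<Rightarrow> nat \<Rightarrow> nat \<Rightarrow> (mono \<Rightarrow> 'r::comm_ring_1) set" where
  "w_filtered n k l = {a. \<forall>m M I. a (m, M, I) \<noteq> 0 \<longrightarrow>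
     valid_mono n (m, M, I) \<and> card I = l \<and> k \<le> size M + 2 * m}"

text \<open>Division by \<open>t\<close>; only used on series without term of order zero in \<open>t\<close>.\<close>

definition div_t :: "(mono \<Rightarrow> 'r::comm_ring_1) \<Rightarrow> mono \<Rightarrow> 'r" where
  "div_t a = (\<lambda>(m, M, I). a (Suc m, M, I))"

text \<open>\<open>id \<otimes> P\<close> on \<open>A \<otimes> W \<otimes> \<Lambda>\<close>, for operators \<open>P\<close> on \<open>W \<otimes> \<Lambda>\<close> that contribute only
  finitely many terms to each coefficient.\<close>

definition extend_op ::
  "nat \<Rightarrow> ('r::comm_ring_1, 'a) module \<Rightarrow> ((mono \<Rightarrow> 'r) \<Rightarrow> mono \<Rightarrow> 'r) \<Rightarrow> (mono \<Rightarrow> 'a) \<Rightarrow> mono \<Rightarrow> 'a" where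
  "extend_op n A P F = (\<lambda>x. \<Oplus>\<^bsub>A\<^esub>Y\<in>{Y. valid_mono n Y \<and> P (monom_w Y) x \<noteq> 0}.
     P (monom_w Y) x \<odot>\<^bsub>A\<^esub> F Y)"


definition const_series :: "('r::comm_ring_1, 'a) module \<Rightarrow> 'a \<Rightarrow> nat \<Rightarrow> 'a" where
  "const_series A a = (\<lambda>m. if m = 0 then a else \<zero>\<^bsub>A\<^esub>)"

definition series_incl :: "('r::comm_ring_1, 'a) module \<Rightarrow> (nat \<Rightarrow> 'a) \<Rightarrow> mono \<Rightarrow> 'a" where
  "series_incl A \<xi> = (\<lambda>(m, M, I). if M = {#} \<and> I = {} then \<xi> m else \<zero>\<^bsub>A\<^esub>)"

definition sigma :: "(mono \<Rightarrow> 'a) \<Rightarrow> nat \<Rightarrow> 'a" where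
  "sigma F = (\<lambda>m. F (m, {#}, {}))"


section \<open>The Fedosov construction\<close>

text \<open>
  \<open>r\<close> and \<open>s\<close> are the coefficient matrices of \<open>r = r\<^sup>i\<^sup>j e\<^sub>i \<otimes> e\<^sub>j\<close> and \<open>s = s\<^sup>i\<^sup>j e\<^sub>i \<otimes> e\<^sub>j\<close>;
  only the entries with indices below \<open>n\<close> matter.
\<close>

locale fedosov =
  fixes \<iota> :: "rat \<Rightarrow> 'r::comm_ring_1"
    and G :: "('r, 'g) module"
    and br :: "'g \<Rightarrow> 'g \<Rightarrow> 'g"
    and n :: nat
    and e :: "nat \<Rightarrow> 'g"
    and nabla :: "'g \<Rightarrow> 'g \<Rightarrow> 'g"
    and r :: "nat \<Rightarrow> nat \<Rightarrow> 'r"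
    and s :: "nat \<Rightarrow> nat \<Rightarrow> 'r"
    and Om :: "mono \<Rightarrow> 'r"
begin

definition is_coord :: "'g \<Rightarrow> (nat \<Rightarrow> 'r) \<Rightarrow> bool" where
  "is_coord x c \<longleftrightarrow> (\<forall>i\<ge>n. c i = 0) \<and> x = (\<Oplus>\<^bsub>G\<^esub>i\<in>{..<n}. c i \<odot>\<^bsub>G\<^esub> e i)"

definition is_basis :: bool where
  "is_basis \<longleftrightarrow> (\<forall>i<n. e i \<in> carrier G) \<and> (\<forall>x\<in>carrier G. \<exists>!c. is_coord x c)"

definition dual_basis :: "nat \<Rightarrow> 'g \<Rightarrow> 'r" where
  "dual_basis i x = (THE c. is_coord x c) i"

subsection \<open>The r-matrix\<close>

text \<open>\<open>r\<^sup>i\<^sup>j e\<^sub>i \<otimes> e\<^sub>j\<close> is the sum over \<open>i < j\<close> of \<open>r\<^sup>i\<^sup>j e\<^sub>i \<and> e\<^sub>j\<close>.\<close>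

definition bivector :: "nat set \<Rightarrow> 'r" where
  "bivector I = (\<Sum>i<n. \<Sum>j\<in>{i<..<n}. if I = {i, j} then r i j else 0)"

definition as_multivector :: "'g \<Rightarrow> nat set \<Rightarrow> 'r" where
  "as_multivector x I = (\<Sum>i<n. if I = {i} then dual_basis i x else 0)"

text \<open>
  In terms of insertions this is the usual formula, the bilinear extension of: the bracket of
  \<open>X\<^sub>1 \<and> \<dots> \<and> X\<^sub>k\<close> with \<open>Y\<^sub>1 \<and> \<dots> \<and> Y\<^sub>l\<close> is the sum over \<open>p, q\<close> of \<open>(-1)\<^sup>p\<^sup>+\<^sup>q\<close> times
  \<open>[X\<^sub>p, Y\<^sub>q]\<close> wedge the remaining \<open>X\<close>'s wedge the remaining \<open>Y\<close>'s.
\<close>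

definition gerstenhaber :: "(nat set \<Rightarrow> 'r) \<Rightarrow> (nat set \<Rightarrow> 'r) \<Rightarrow> nat set \<Rightarrow> 'r" where
  "gerstenhaber a b K = (\<Sum>i<n. \<Sum>j<n.
     wedge (as_multivector (br (e i) (e j))) (wedge (contract i a) (contract j b)) K)"

definition classical_r_matrix :: bool where
  "classical_r_matrix \<longleftrightarrow> (\<forall>i<n. \<forall>j<n. r i j = - r j i) \<and> (\<forall>i<n. r i i = 0) \<and>
     (\<forall>K. gerstenhaber bivector bivector K = 0)"

definition is_inverse :: "(nat \<Rightarrow> nat \<Rightarrow> 'r) \<Rightarrow> bool" where
  "is_inverse w \<longleftrightarrow> (\<forall>i j. n \<le> i \<or> n \<le> j \<longrightarrow> w i j = 0) \<and>
     (\<forall>i<n. \<forall>k<n. (\<Sum>j<n. r i j * w j k) = (if i = k then 1 else 0)) \<and>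
     (\<forall>i<n. \<forall>k<n. (\<Sum>j<n. w i j * r j k) = (if i = k then 1 else 0))"

definition nondegenerate :: bool where
  "nondegenerate \<longleftrightarrow> (\<exists>w. is_inverse w)"

text \<open>\<open>\<omega>\<^sub>i\<^sub>j e\<^sup>i \<otimes> e\<^sup>j\<close>, that is half of \<open>\<omega>\<^sub>i\<^sub>j e\<^sup>i \<and> e\<^sup>j\<close>, as a bilinear form.\<close>

definition omega :: "'g \<Rightarrow> 'g \<Rightarrow> 'r" where
  "omega x y = (\<Sum>i<n. \<Sum>j<n. (THE w. is_inverse w) i j * dual_basis i x * dual_basis j y)"

subsection \<open>Covariant derivatives\<close>

definition torsion_free :: bool where
  "torsion_free \<longleftrightarrow> (\<forall>x\<in>carrier G. \<forall>y\<in>carrier G. nabla x y \<ominus>\<^bsub>G\<^esub> nabla y x = br x y)"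

definition symplectic :: bool where
  "symplectic \<longleftrightarrow> (\<forall>x\<in>carrier G. \<forall>y\<in>carrier G. \<forall>z\<in>carrier G.
     - omega (nabla x y) z - omega y (nabla x z) = 0)"

text \<open>The coefficient of \<open>e\<^sub>k \<otimes> e\<^sub>l\<close> in \<open>\<nabla>\<^sub>x s\<close>.\<close>

definition nabla_s :: "'g \<Rightarrow> nat \<Rightarrow> nat \<Rightarrow> 'r" where
  "nabla_s x k l = (\<Sum>i<n. s i l * dual_basis k (nabla x (e i))) +
     (\<Sum>j<n. s k j * dual_basis l (nabla x (e j)))"

definition parallel_s :: bool where
  "parallel_s \<longleftrightarrow> (\<forall>i<n. \<forall>j<n. s i j = s j i) \<and>
     (\<forall>x\<in>carrier G. \<forall>k<n. \<forall>l<n. nabla_s x k l = 0)"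

definition curvature :: "'g \<Rightarrow> 'g \<Rightarrow> 'g \<Rightarrow> 'g" where
  "curvature x y z = nabla x (nabla y z) \<ominus>\<^bsub>G\<^esub> nabla y (nabla x z) \<ominus>\<^bsub>G\<^esub> nabla (br x y) z"

definition curv_elem :: "mono \<Rightarrow> 'r" where
  "curv_elem x = (\<Sum>i<n. \<Sum>j<n. \<Sum>k<n. \<Sum>l<n.
     \<iota> (1 / 4) * omega (e k) (curvature (e i) (e j) (e l)) *
     w_mult (w_mult (sym_gen k) (sym_gen l)) (w_mult (ext_gen i) (ext_gen j)) x)"

subsection \<open>Operators on the Weyl algebra\<close>

definition delta :: "(mono \<Rightarrow> 'r) \<Rightarrow> mono \<Rightarrow> 'r" where
  "delta a x = (\<Sum>i<n. w_mult (ext_gen i) (ins_sym i a) x)"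

text \<open>The operator preserves the sum of the symmetric and the antisymmetric degree, so the
  factor may be read off from the target monomial.\<close>

definition delta_inv :: "(mono \<Rightarrow> 'r) \<Rightarrow> mono \<Rightarrow> 'r" where
  "delta_inv a = (\<lambda>(m, M, I). if size M + card I = 0 then 0
     else \<iota> (1 / of_nat (size M + card I)) *
       (\<Sum>i<n. w_mult (sym_gen i) (ins_ext i a) (m, M, I)))"

text \<open>\<open>\<mu> \<circ> P\<^sup>q\<close> with \<open>P = \<pi>\<^sup>i\<^sup>j i\<^sub>s(e\<^sub>i) \<otimes> i\<^sub>s(e\<^sub>j)\<close> and \<open>\<pi> = r + s\<close>.\<close>

fun mult_P_pow :: "nat \<Rightarrow> (mono \<Rightarrow> 'r) \<Rightarrow> (mono \<Rightarrow> 'r) \<Rightarrow> mono \<Rightarrow> 'r" where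
  "mult_P_pow 0 a b x = w_mult a b x"
| "mult_P_pow (Suc q) a b x =
     (\<Sum>i<n. \<Sum>j<n. (r i j + s i j) * mult_P_pow q (ins_sym i a) (ins_sym j b) x)"

definition circ :: "(mono \<Rightarrow> 'r) \<Rightarrow> (mono \<Rightarrow> 'r) \<Rightarrow> mono \<Rightarrow> 'r" where
  "circ a b = (\<lambda>(m, M, I). \<Sum>q\<le>m. \<iota> (1 / (2 ^ q * fact q)) * mult_P_pow q a b (m - q, M, I))"

definition ad :: "(mono \<Rightarrow> 'r) \<Rightarrow> (mono \<Rightarrow> 'r) \<Rightarrow> mono \<Rightarrow> 'r" where
  "ad a b x = (\<Sum>k\<le>n. \<Sum>l\<le>n.
     circ (ext_part k a) (ext_part l b) x - (- 1) ^ (k * l) * circ (ext_part l b) (ext_part k a) x)"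

text \<open>\<open>\<nabla>\<^bsub>e i\<^esub>\<close> on symmetric powers, the derivation with
  \<open>\<nabla>\<^bsub>e i\<^esub> e\<^sup>k = - e\<^sup>k(\<nabla>\<^bsub>e i\<^esub> e\<^sub>j) e\<^sup>j\<close>.\<close>

definition nabla_sym :: "nat \<Rightarrow> (mono \<Rightarrow> 'r) \<Rightarrow> mono \<Rightarrow> 'r" where
  "nabla_sym i a x = (\<Sum>j<n. \<Sum>k<n.
     - dual_basis k (nabla (e i) (e j)) * w_mult (sym_gen j) (ins_sym k a) x)"

text \<open>
  Evaluation on \<open>e\<^sub>i\<close>, \<open>i \<in> I\<close>, in increasing order of the usual formula: the sum over
  \<open>p < q\<close> of \<open>(-1)\<^sup>p\<^sup>+\<^sup>q\<close> times \<open>\<alpha>([X\<^sub>p, X\<^sub>q], \<dots>)\<close>, with \<open>X\<^sub>p\<close> and \<open>X\<^sub>q\<close> omitted from the dots.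
\<close>

definition delta_CE :: "(mono \<Rightarrow> 'r) \<Rightarrow> mono \<Rightarrow> 'r" where
  "delta_CE a = (\<lambda>(m, M, I). if I \<subseteq> {..<n} then
     (\<Sum>i\<in>I. \<Sum>j\<in>{j \<in> I. i < j}.
        (- 1) ^ (card {l \<in> I. l < i} + card {l \<in> I. l < j}) *
        (\<Sum>k<n. dual_basis k (br (e i) (e j)) * ins_ext k a (m, M, I - {i, j})))
     else 0)"

definition D :: "(mono \<Rightarrow> 'r) \<Rightarrow> mono \<Rightarrow> 'r" where
  "D a x = (\<Sum>i<n. w_mult (ext_gen i) (nabla_sym i a) x) + delta_CE a x"

definition closed_series :: bool where
  "closed_series \<longleftrightarrow>
     (\<forall>m M I. Om (m, M, I) \<noteq> 0 \<longrightarrow> 1 \<le> m \<and> M = {#} \<and> I \<subseteq> {..<n} \<and> card I = 2) \<and>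
     (\<forall>x. delta_CE Om x = 0)"

definition fedosov_equation :: "(mono \<Rightarrow> 'r) \<Rightarrow> bool" where
  "fedosov_equation \<rho> \<longleftrightarrow> \<rho> \<in> w_filtered n 2 1 \<and>
     (\<forall>x. delta \<rho> x = curv_elem x + D \<rho> x + div_t (circ \<rho> \<rho>) x + Om x) \<and>
     (\<forall>x. delta_inv \<rho> x = 0)"

text \<open>
  By Fedosov's theorem the solution exists and is unique under the standing assumptions; the
  value 0 is a dummy outside of them.
\<close>

definition rho :: "mono \<Rightarrow> 'r" where
  "rho = (if \<exists>!\<rho>. fedosov_equation \<rho> then THE \<rho>. fedosov_equation \<rho> else (\<lambda>x. 0))"

subsection \<open>The star product\<close>

definition L_op :: "('r, 'a) module \<Rightarrow> ('g \<Rightarrow> 'a \<Rightarrow> 'a) \<Rightarrow> (mono \<Rightarrow> 'a) \<Rightarrow> mono \<Rightarrow> 'a" where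
  "L_op A act F x = (\<Oplus>\<^bsub>A\<^esub>i\<in>{..<n}.
     extend_op n A (w_mult (ext_gen i)) (\<lambda>Y. act (e i) (F Y)) x)"

definition fedosov_derivation ::
  "('r, 'a) module \<Rightarrow> ('g \<Rightarrow> 'a \<Rightarrow> 'a) \<Rightarrow> (mono \<Rightarrow> 'a) \<Rightarrow> mono \<Rightarrow> 'a" where
  "fedosov_derivation A act F x =
     extend_op n A D F x \<oplus>\<^bsub>A\<^esub> L_op A act F x \<oplus>\<^bsub>A\<^esub> extend_op n A (\<lambda>b. div_t (ad rho b)) F x"

definition tau_step :: "('r, 'a) module \<Rightarrow> ('g \<Rightarrow> 'a \<Rightarrow> 'a) \<Rightarrow> (mono \<Rightarrow> 'a) \<Rightarrow> mono \<Rightarrow> 'a" where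
  "tau_step A act F x =
     extend_op n A delta_inv (fedosov_derivation A act F) x \<oplus>\<^bsub>A\<^esub>
     fedosov_derivation A act (extend_op n A delta_inv F) x"

text \<open>\<open>tau_step\<close> raises the total degree, so each coefficient of the series over \<open>k\<close> is a
  finite sum.\<close>

definition tau :: "('r, 'a) module \<Rightarrow> ('g \<Rightarrow> 'a \<Rightarrow> 'a) \<Rightarrow> (nat \<Rightarrow> 'a) \<Rightarrow> mono \<Rightarrow> 'a" where
  "tau A act \<xi> x =
     (\<Oplus>\<^bsub>A\<^esub>k\<in>{k. (tau_step A act ^^ k) (series_incl A \<xi>) x \<noteq> \<zero>\<^bsub>A\<^esub>}.
        (tau_step A act ^^ k) (series_incl A \<xi>) x)"

definition m_pi :: "('r, 'a) module \<Rightarrow> (mono \<Rightarrow> 'a) \<Rightarrow> (mono \<Rightarrow> 'a) \<Rightarrow> mono \<Rightarrow> 'a" where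
  "m_pi A F H x =
     (\<Oplus>\<^bsub>A\<^esub>p\<in>{(Y, Z). valid_mono n Y \<and> valid_mono n Z \<and> circ (monom_w Y) (monom_w Z) x \<noteq> 0}.
        circ (monom_w (fst p)) (monom_w (snd p)) x \<odot>\<^bsub>A\<^esub> (F (fst p) \<otimes>\<^bsub>A\<^esub> H (snd p)))"

definition star ::
  "('r, 'a) module \<Rightarrow> ('g \<Rightarrow> 'a \<Rightarrow> 'a) \<Rightarrow> (nat \<Rightarrow> 'a) \<Rightarrow> (nat \<Rightarrow> 'a) \<Rightarrow> nat \<Rightarrow> 'a" where
  "star A act \<xi> \<eta> = sigma (m_pi A (tau A act \<xi>) (tau A act \<eta>))"

text \<open>\<open>1 \<star> 1\<close>, where 1 is the unit of the enveloping algebra, an element of degree 1 of the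
  tensor algebra.\<close>

definition twist :: "nat \<Rightarrow> (('g list \<Rightarrow>\<^sub>0 'r) set set list \<Rightarrow>\<^sub>0 'r) set" where
  "twist =
     (let U = enveloping_algebra G br;
          unit = const_series (tensor_algebra U) (tensor U [\<one>\<^bsub>U\<^esub>])
      in star (tensor_algebra U) (tensor_enveloping_act G br) unit unit)"

end

locale fedosov_data = fedosov +
  assumes rat: "contains_rat \<iota>"
    and lie: "lie_algebra G br"
    and basis: "is_basis"
    and r_matrix: "classical_r_matrix"
    and r_nondegenerate: "nondegenerate"
    and nabla_bilinear: "bilinear_map G G G nabla"
    and nabla_torsion_free: "torsion_free"
    and nabla_symplectic: "symplectic"
    and s_parallel: "parallel_s"
    and Om_closed: "closed_series"

end

theory Submission
  imports Defs
begin

text \<open>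
  The Fedosov star product is obtained from the Fedosov-Taylor series \<open>\<tau>\<close>, and \<open>\<tau>\<close> uses
  nothing of the algebra but its module structure and the action of the Lie algebra. It is
  therefore natural: a linear map that intertwines two actions intertwines the corresponding
  series, coefficient by coefficient (\<open>tau_natural\<close>).

  This is applied to the enveloping algebra \<open>U\<close> itself, on which the Lie algebra acts by left
  multiplication. Let \<open>T\<close> be the series of \<open>1 \<in> U\<close>, a family of elements of \<open>U\<close> indexed by
  the monomials of the Weyl algebra (\<open>universal_tau\<close>). For \<open>a \<in> A\<close> the map \<open>u \<mapsto> u \<rhd> a\<close> from
  \<open>U\<close> to \<open>A\<close> is equivariant and sends \<open>1\<close> to \<open>a\<close>; for the tensor algebra of \<open>U\<close>, the inclusion
  of \<open>U\<close> as its degree one part is equivariant. Hence the series of \<open>a\<close> has the coefficients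
  \<open>T Y \<rhd> a\<close>, and the series of \<open>1\<close> in the tensor algebra has the coefficients \<open>T Y\<close>
  (\<open>tau_eq_act\<close>, \<open>tau_eq_tensor\<close>).

  The product of two series is, in each power of \<open>t\<close>, a linear combination of products of
  coefficients, with scalars \<open>c Y Z\<close> that do not depend on the algebra. So the twist is the sum of
  the \<open>c Y Z\<close> times \<open>T Y \<otimes> T Z\<close>, which lies in \<open>U \<otimes> U\<close>, while the star product of \<open>a\<close> and \<open>b\<close>
  is the sum of the \<open>c Y Z\<close> times \<open>(T Y \<rhd> a) \<cdot> (T Z \<rhd> b)\<close>. The second is what the action of the
  first on \<open>a \<otimes> b\<close> followed by the multiplication gives, because that operation is linear in the
  element of \<open>U \<otimes> U\<close>.

  Two points need work. The operations on tensor and enveloping algebras are given by choices of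
  representatives, and have to be shown independent of these and linear. And a coefficient of \<open>\<tau>\<close>
  is a sum over the nonvanishing terms of a series; a linear map may kill some of infinitely many
  terms and thus change a sum that is 0 by convention into a proper one, so naturality needs these
  sums to be finite. They are, because each step of the series raises the total degree
  (\<open>tau_step_vanishes_below\<close>).
\<close>


section \<open>Linear maps between modules\<close>

lemma ground_simps [simp]:
  "carrier (ground :: 'r::comm_ring_1 ring) = UNIV"
  "(x::'r) \<oplus>\<^bsub>ground\<^esub> y = x + y" "(x::'r) \<otimes>\<^bsub>ground\<^esub> y = x * y"
  "\<zero>\<^bsub>ground :: 'r ring\<^esub> = 0" "\<one>\<^bsub>ground :: 'r ring\<^esub> = 1"
  by (simp_all add: ring_of_type_algebra_def)

definition linear_map ::
  "('r::comm_ring_1, 'a) module \<Rightarrow> ('r, 'b) module \<Rightarrow> ('a \<Rightarrow> 'b) \<Rightarrow> bool" where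
  "linear_map M N f \<longleftrightarrow>
     (\<forall>x\<in>carrier M. f x \<in> carrier N) \<and>
     (\<forall>x\<in>carrier M. \<forall>y\<in>carrier M. f (x \<oplus>\<^bsub>M\<^esub> y) = f x \<oplus>\<^bsub>N\<^esub> f y) \<and>
     (\<forall>c. \<forall>x\<in>carrier M. f (c \<odot>\<^bsub>M\<^esub> x) = c \<odot>\<^bsub>N\<^esub> f x)"

lemma linear_mapI:
  assumes "\<And>x. x \<in> carrier M \<Longrightarrow> f x \<in> carrier N"
    and "\<And>x y. x \<in> carrier M \<Longrightarrow> y \<in> carrier M \<Longrightarrow> f (x \<oplus>\<^bsub>M\<^esub> y) = f x \<oplus>\<^bsub>N\<^esub> f y"
    and "\<And>c x. x \<in> carrier M \<Longrightarrow> f (c \<odot>\<^bsub>M\<^esub> x) = c \<odot>\<^bsub>N\<^esub> f x"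
  shows "linear_map M N f"
  using assms by (auto simp: linear_map_def)

lemma linear_mapD:
  assumes "linear_map M N f"
  shows "x \<in> carrier M \<Longrightarrow> f x \<in> carrier N"
    and "x \<in> carrier M \<Longrightarrow> y \<in> carrier M \<Longrightarrow> f (x \<oplus>\<^bsub>M\<^esub> y) = f x \<oplus>\<^bsub>N\<^esub> f y"
    and "x \<in> carrier M \<Longrightarrow> f (c \<odot>\<^bsub>M\<^esub> x) = c \<odot>\<^bsub>N\<^esub> f x"
  using assms by (auto simp: linear_map_def)

lemma linear_map_comp:
  assumes "linear_map M N f" "linear_map N P g"
  shows "linear_map M P (\<lambda>x. g (f x))"
  using assms by (auto simp: linear_map_def)

lemma linear_map_zero:
  assumes "module ground M" "module ground N" "linear_map M N f"
  shows "f \<zero>\<^bsub>M\<^esub> = \<zero>\<^bsub>N\<^esub>"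
proof -
  interpret M: module ground M by fact
  interpret N: module ground N by fact
  have "f (0 \<odot>\<^bsub>M\<^esub> \<zero>\<^bsub>M\<^esub>) = 0 \<odot>\<^bsub>N\<^esub> f \<zero>\<^bsub>M\<^esub>"
    using linear_mapD(3)[OF assms(3)] by blast
  moreover have "f \<zero>\<^bsub>M\<^esub> \<in> carrier N"
    using linear_mapD(1)[OF assms(3)] by blast
  ultimately show ?thesis
    using M.smult_l_null[of "\<zero>\<^bsub>M\<^esub>"] N.smult_l_null[of "f \<zero>\<^bsub>M\<^esub>"] by simp
qed

text \<open>
  A sum over an infinite index set is 0, and linear maps preserve 0. The lemma thus applies to
  sums over all monomials that contribute to a coefficient, with no count of these monomials.
\<close>
lemma linear_map_finsum:
  assumes "module ground M" "module ground N" "linear_map M N f" "g \<in> I \<rightarrow> carrier M"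
  shows "f (\<Oplus>\<^bsub>M\<^esub>i\<in>I. g i) = (\<Oplus>\<^bsub>N\<^esub>i\<in>I. f (g i))"
proof -
  interpret M: module ground M by fact
  interpret N: module ground N by fact
  note zero = linear_map_zero[OF assms(1-3)]
  show ?thesis
    using assms(4)
  proof (induction I rule: infinite_finite_induct)
    case (insert i I)
    then have g: "g \<in> I \<rightarrow> carrier M" "g i \<in> carrier M" by auto
    then have "(\<lambda>i. f (g i)) \<in> I \<rightarrow> carrier N" "f (g i) \<in> carrier N"
      using linear_mapD(1)[OF assms(3)] by auto
    with g insert show ?case
      by (simp add: linear_mapD(2)[OF assms(3)])
  qed (simp_all add: zero)
qed

lemma (in module) finsum_smult:
  assumes "c \<in> carrier R" "g \<in> I \<rightarrow> carrier M"
  shows "c \<odot>\<^bsub>M\<^esub> (\<Oplus>\<^bsub>M\<^esub>i\<in>I. g i) = (\<Oplus>\<^bsub>M\<^esub>i\<in>I. c \<odot>\<^bsub>M\<^esub> g i)"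
proof (cases "finite I")
  case True
  then show ?thesis using finsum_smult_ldistr assms by blast
qed (use assms in simp)

lemma linear_map_minus:
  assumes "module ground M" "module ground N" "linear_map M N f" "x \<in> carrier M" "y \<in> carrier M"
  shows "f (x \<ominus>\<^bsub>M\<^esub> y) = f x \<ominus>\<^bsub>N\<^esub> f y"
proof -
  interpret M: module ground M by fact
  interpret N: module ground N by fact
  have "f (x \<ominus>\<^bsub>M\<^esub> y) \<oplus>\<^bsub>N\<^esub> f y = f ((x \<ominus>\<^bsub>M\<^esub> y) \<oplus>\<^bsub>M\<^esub> y)"
    using linear_mapD(2)[OF assms(3)] assms(4,5) by simp
  also have "(x \<ominus>\<^bsub>M\<^esub> y) \<oplus>\<^bsub>M\<^esub> y = x"
    using assms(4,5) by (simp add: M.minus_eq M.a_assoc M.l_neg)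
  finally have "f x = f (x \<ominus>\<^bsub>M\<^esub> y) \<oplus>\<^bsub>N\<^esub> f y" by simp
  moreover have "f (x \<ominus>\<^bsub>M\<^esub> y) \<in> carrier N" "f y \<in> carrier N"
    using linear_mapD(1)[OF assms(3)] assms(4,5) by simp_all
  ultimately show ?thesis
    by (simp add: N.minus_eq N.a_assoc N.r_neg)
qed

lemma linear_map_scaled:
  assumes "module ground N" "linear_map M N f"
  shows "linear_map M N (\<lambda>x. c \<odot>\<^bsub>N\<^esub> f x)"
proof -
  interpret N: module ground N by fact
  show ?thesis
    using linear_mapD[OF assms(2)]
    by (intro linear_mapI)
       (simp_all add: N.smult_closed[simplified] N.smult_r_distr mult.commute
          flip: N.smult_assoc1[simplified])
qed

lemma linear_map_sum:
  assumes "module ground N" "linear_map M N f" "linear_map M N g"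
  shows "linear_map M N (\<lambda>x. f x \<oplus>\<^bsub>N\<^esub> g x)"
proof -
  interpret N: module ground N by fact
  show ?thesis
    using linear_mapD[OF assms(2)] linear_mapD[OF assms(3)]
    by (intro linear_mapI) (simp_all add: N.smult_r_distr N.a_ac)
qed

lemma linear_map_finsum_fun:
  assumes "module ground N" "\<And>i. i \<in> I \<Longrightarrow> linear_map M N (f i)"
  shows "linear_map M N (\<lambda>x. \<Oplus>\<^bsub>N\<^esub>i\<in>I. f i x)"
proof -
  interpret N: module ground N by fact
  note f = linear_mapD[OF assms(2)]
  show ?thesis
  proof (rule linear_mapI)
    fix x y assume xy: "x \<in> carrier M" "y \<in> carrier M"
    have "(\<Oplus>\<^bsub>N\<^esub>i\<in>I. f i (x \<oplus>\<^bsub>M\<^esub> y)) = (\<Oplus>\<^bsub>N\<^esub>i\<in>I. f i x \<oplus>\<^bsub>N\<^esub> f i y)"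
      using f xy by (intro N.finsum_cong') auto
    also have "\<dots> = (\<Oplus>\<^bsub>N\<^esub>i\<in>I. f i x) \<oplus>\<^bsub>N\<^esub> (\<Oplus>\<^bsub>N\<^esub>i\<in>I. f i y)"
      using f xy by (intro N.finsum_addf) auto
    finally show "(\<Oplus>\<^bsub>N\<^esub>i\<in>I. f i (x \<oplus>\<^bsub>M\<^esub> y)) = (\<Oplus>\<^bsub>N\<^esub>i\<in>I. f i x) \<oplus>\<^bsub>N\<^esub> (\<Oplus>\<^bsub>N\<^esub>i\<in>I. f i y)" .
  next
    fix c x assume x: "x \<in> carrier M"
    have "(\<Oplus>\<^bsub>N\<^esub>i\<in>I. f i (c \<odot>\<^bsub>M\<^esub> x)) = (\<Oplus>\<^bsub>N\<^esub>i\<in>I. c \<odot>\<^bsub>N\<^esub> f i x)"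
      using f x N.smult_closed by (intro N.finsum_cong') auto
    also have "\<dots> = c \<odot>\<^bsub>N\<^esub> (\<Oplus>\<^bsub>N\<^esub>i\<in>I. f i x)"
      using f x by (intro N.finsum_smult[symmetric]) auto
    finally show "(\<Oplus>\<^bsub>N\<^esub>i\<in>I. f i (c \<odot>\<^bsub>M\<^esub> x)) = c \<odot>\<^bsub>N\<^esub> (\<Oplus>\<^bsub>N\<^esub>i\<in>I. f i x)" .
  qed (use f in auto)
qed

lemma linear_map_const_zero:
  assumes "module ground N"
  shows "linear_map M N (\<lambda>x. \<zero>\<^bsub>N\<^esub>)"
proof -
  interpret N: module ground N by fact
  show ?thesis by (intro linear_mapI) (simp_all add: N.smult_r_null)
qed

lemma bilinear_map_linear:
  assumes "bilinear_map M N P f"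
  shows "y \<in> carrier N \<Longrightarrow> linear_map M P (\<lambda>x. f x y)"
    and "x \<in> carrier M \<Longrightarrow> linear_map N P (f x)"
  using assms by (auto simp: bilinear_map_def linear_map_def)

lemma bilinear_mapI:
  assumes "\<And>y. y \<in> carrier N \<Longrightarrow> linear_map M P (\<lambda>x. f x y)"
    and "\<And>x. x \<in> carrier M \<Longrightarrow> linear_map N P (f x)"
  shows "bilinear_map M N P f"
  using linear_mapD[OF assms(1)] linear_mapD(2,3)[OF assms(2)] by (simp add: bilinear_map_def)

lemma bilinear_map_comp:
  assumes "bilinear_map M N P f" "linear_map M' M g" "linear_map N' N h"
  shows "bilinear_map M' N' P (\<lambda>x y. f (g x) (h y))"
  using linear_mapD[OF assms(2)] linear_mapD[OF assms(3)]
    linear_map_comp[OF assms(2) bilinear_map_linear(1)[OF assms(1)]]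
    linear_map_comp[OF assms(3) bilinear_map_linear(2)[OF assms(1)]]
  by (intro bilinear_mapI) simp_all


section \<open>Unital algebras and their quotients\<close>

text \<open>Closure under negation comes from multiplication by \<open>\<ominus> \<one>\<close>.\<close>
lemma (in ring) idealI_closed:
  assumes "K \<subseteq> carrier R" "\<zero> \<in> K"
    and add: "\<And>x y. x \<in> K \<Longrightarrow> y \<in> K \<Longrightarrow> x \<oplus> y \<in> K"
    and left: "\<And>x z. x \<in> carrier R \<Longrightarrow> z \<in> K \<Longrightarrow> x \<otimes> z \<in> K"
    and right: "\<And>x z. x \<in> carrier R \<Longrightarrow> z \<in> K \<Longrightarrow> z \<otimes> x \<in> K"
  shows "ideal K R"
proof (rule idealI)
  have "\<ominus> x \<in> K" if "x \<in> K" for x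
    using left[of "\<ominus> \<one>" x] that assms(1) by (auto simp: l_minus)
  then show "subgroup K (add_monoid R)"
    using assms(1,2) add by (intro add.subgroupI) auto
qed (use ring_axioms left right in auto)

text \<open>Associative unital algebras that need not be commutative, in contrast to the locale
  \<open>algebra\<close>.\<close>
locale unital_algebra = module ground F + ring F for F :: "('r::comm_ring_1, 'a) module" (structure) +
  assumes smult_mult_left: "x \<in> carrier F \<Longrightarrow> y \<in> carrier F \<Longrightarrow> c \<odot> (x \<otimes> y) = (c \<odot> x) \<otimes> y"
    and smult_mult_right: "x \<in> carrier F \<Longrightarrow> y \<in> carrier F \<Longrightarrow> c \<odot> (x \<otimes> y) = x \<otimes> (c \<odot> y)"
begin

lemma smult_in [simp, intro]: "x \<in> carrier F \<Longrightarrow> c \<odot> x \<in> carrier F"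
  by (rule smult_closed) simp_all

lemma quotient_zero [simp]: "\<zero>\<^bsub>quotient_algebra F J\<^esub> = J"
  and quotient_one: "\<one>\<^bsub>quotient_algebra F J\<^esub> = J +> \<one>"
  by (simp_all add: quotient_algebra_def FactRing_def)

lemma quotient_carrier: "carrier (quotient_algebra F J) = (\<lambda>x. J +> x) ` carrier F"
  by (auto simp: quotient_algebra_def FactRing_def A_RCOSETS_def' a_r_coset_def')

context
  fixes J
  assumes J: "ideal J F"
begin

interpretation J: ideal J F by (fact J)

lemma quotient_add: "x \<in> carrier F \<Longrightarrow> y \<in> carrier F \<Longrightarrow>
    (J +> x) \<oplus>\<^bsub>quotient_algebra F J\<^esub> (J +> y) = J +> (x \<oplus> y)"
  by (simp add: quotient_algebra_def FactRing_def J.a_rcos_sum)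

lemma quotient_mult: "x \<in> carrier F \<Longrightarrow> y \<in> carrier F \<Longrightarrow>
    (J +> x) \<otimes>\<^bsub>quotient_algebra F J\<^esub> (J +> y) = J +> (x \<otimes> y)"
  by (simp add: quotient_algebra_def FactRing_def J.rcoset_mult_add)

lemma quotient_smult: "x \<in> carrier F \<Longrightarrow>
    c \<odot>\<^bsub>quotient_algebra F J\<^esub> (J +> x) = J +> (c \<odot> x)"
  using smult_mult_left[of \<one> x c]
  by (simp add: quotient_algebra_def FactRing_def J.rcoset_mult_add)

lemma quotient_abelian_group: "abelian_group (quotient_algebra F J)"
proof -
  have J0: "J +> \<zero> = J" by (simp add: a_coset_add_zero J.a_subset)
  show ?thesis
  proof (rule abelian_groupI)
    fix Z assume "Z \<in> carrier (quotient_algebra F J)"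
    then obtain x where x: "x \<in> carrier F" "Z = J +> x" by (auto simp: quotient_carrier)
    show "\<zero>\<^bsub>quotient_algebra F J\<^esub> \<oplus>\<^bsub>quotient_algebra F J\<^esub> Z = Z"
      using quotient_add[of \<zero> x] x by (simp add: J0)
    have "(J +> \<ominus> x) \<oplus>\<^bsub>quotient_algebra F J\<^esub> Z = \<zero>\<^bsub>quotient_algebra F J\<^esub>"
      using quotient_add[of "\<ominus> x" x] x by (simp add: J0 l_neg)
    then show "\<exists>Y\<in>carrier (quotient_algebra F J).
        Y \<oplus>\<^bsub>quotient_algebra F J\<^esub> Z = \<zero>\<^bsub>quotient_algebra F J\<^esub>"
      using x by (auto simp: quotient_carrier)
  next
    show "\<zero>\<^bsub>quotient_algebra F J\<^esub> \<in> carrier (quotient_algebra F J)"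
      using J0 by (auto simp: quotient_carrier)
  qed (auto simp: quotient_carrier quotient_add a_ac)
qed

lemma quotient_unital_algebra: "unital_algebra (quotient_algebra F J)"
proof -
  interpret Q: abelian_group "quotient_algebra F J" by (rule quotient_abelian_group)
  have "Group.monoid (quotient_algebra F J)"
    by (rule monoidI) (auto simp: quotient_carrier quotient_one quotient_mult m_assoc)
  then have ring: "ring (quotient_algebra F J)"
    by (intro ringI quotient_abelian_group)
       (auto simp: quotient_carrier quotient_add quotient_mult l_distr r_distr)
  have module: "module ground (quotient_algebra F J)"
  proof (rule moduleI)
    show "cring (ground :: 'r ring)" by (rule cring_from_type_algebra)
  qed (use smult_l_distr smult_r_distr smult_assoc1 smult_one in
      \<open>auto simp: quotient_carrier quotient_add quotient_smult quotient_abelian_group\<close>)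
  show ?thesis
  proof (intro unital_algebra.intro module ring unital_algebra_axioms.intro)
    show "c \<odot>\<^bsub>quotient_algebra F J\<^esub> (x \<otimes>\<^bsub>quotient_algebra F J\<^esub> y) =
        c \<odot>\<^bsub>quotient_algebra F J\<^esub> x \<otimes>\<^bsub>quotient_algebra F J\<^esub> y"
      if "x \<in> carrier (quotient_algebra F J)" "y \<in> carrier (quotient_algebra F J)" for x y c
      using that smult_mult_left by (auto simp: quotient_carrier quotient_mult quotient_smult)
    show "c \<odot>\<^bsub>quotient_algebra F J\<^esub> (x \<otimes>\<^bsub>quotient_algebra F J\<^esub> y) =
        x \<otimes>\<^bsub>quotient_algebra F J\<^esub> (c \<odot>\<^bsub>quotient_algebra F J\<^esub> y)"
      if "x \<in> carrier (quotient_algebra F J)" "y \<in> carrier (quotient_algebra F J)" for x y c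
      using that smult_mult_right by (auto simp: quotient_carrier quotient_mult quotient_smult)
  qed
qed

text \<open>Two representatives differ by an element of the ideal, where \<open>f\<close> vanishes.\<close>
lemma quotient_representative:
  assumes "module ground V" "linear_map F V f" "\<And>x. x \<in> J \<Longrightarrow> f x = \<zero>\<^bsub>V\<^esub>" "x \<in> carrier F"
  shows "f (SOME p. p \<in> J +> x) = f x"
proof -
  interpret V: module ground V by fact
  have "(SOME p. p \<in> J +> x) \<in> J +> x"
    using J.a_rcos_self[OF assms(4)] by (rule someI)
  then obtain j where j: "j \<in> J" "(SOME p. p \<in> J +> x) = j \<oplus> x"
    by (auto simp: a_r_coset_def')
  then have "f (SOME p. p \<in> J +> x) = f j \<oplus>\<^bsub>V\<^esub> f x"
    using linear_mapD(2)[OF assms(2)] assms(4) J.Icarr by simp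
  then show ?thesis
    using assms(3)[OF j(1)] linear_mapD(1)[OF assms(2,4)] by simp
qed

lemma linear_map_quotient:
  assumes "module ground V" "linear_map F V f" "\<And>x. x \<in> J \<Longrightarrow> f x = \<zero>\<^bsub>V\<^esub>"
  shows "linear_map (quotient_algebra F J) V (\<lambda>Z. f (SOME p. p \<in> Z))"
  using linear_mapD[OF assms(2)]
  by (intro linear_mapI)
     (auto simp: quotient_carrier quotient_add quotient_smult quotient_representative[OF assms])

end

end


section \<open>Linear extension from words\<close>

lemma free_algebra_simps [simp]:
  "carrier (free_algebra S) = {p. Poly_Mapping.keys p \<subseteq> lists S}"
  "p \<otimes>\<^bsub>free_algebra S\<^esub> q = p * q" "\<one>\<^bsub>free_algebra S\<^esub> = 1"
  "p \<oplus>\<^bsub>free_algebra S\<^esub> q = p + q" "\<zero>\<^bsub>free_algebra S\<^esub> = 0"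
  "c \<odot>\<^bsub>free_algebra S\<^esub> p = Poly_Mapping.single [] c * p"
  by (simp_all add: free_algebra_def)

lemma single_mult_single_list:
  "Poly_Mapping.single u c * Poly_Mapping.single v d = Poly_Mapping.single (u @ v) (c * d)"
  by (simp add: mult_single plus_list_def)

lemma keys_mult_lists:
  assumes "Poly_Mapping.keys p \<subseteq> lists S" "Poly_Mapping.keys q \<subseteq> lists S"
  shows "Poly_Mapping.keys (p * q) \<subseteq> lists S"
proof
  fix w assume "w \<in> Poly_Mapping.keys (p * q)"
  then obtain u v where "u \<in> Poly_Mapping.keys p" "v \<in> Poly_Mapping.keys q" "w = u @ v"
    using keys_mult[of p q] by (auto simp: plus_list_def)
  then show "w \<in> lists S" using assms by (meson append_in_lists_conv subsetD)
qed

lemma one_list: "1 = Poly_Mapping.single [] 1"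
  by (metis single_one zero_list_def)

lemma keys_single_subset: "w \<in> A \<Longrightarrow> Poly_Mapping.keys (Poly_Mapping.single w c) \<subseteq> A"
  by (cases "c = 0") auto

lemma keys_single_list [simp]:
  "w \<in> lists S \<Longrightarrow> Poly_Mapping.keys (Poly_Mapping.single w c) \<subseteq> lists S"
  by (rule keys_single_subset)

lemma keys_uminus: "Poly_Mapping.keys (- p) = Poly_Mapping.keys (p :: _ \<Rightarrow>\<^sub>0 'r::comm_ring_1)"
  by (auto simp: in_keys_iff)

lemma keys_subset_induct [consumes 1, case_names zero single add]:
  assumes "Poly_Mapping.keys p \<subseteq> A" "P 0"
    and "\<And>w c. w \<in> A \<Longrightarrow> P (Poly_Mapping.single w c)"
    and "\<And>p q. Poly_Mapping.keys p \<subseteq> A \<Longrightarrow> Poly_Mapping.keys q \<subseteq> A \<Longrightarrow>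
           P p \<Longrightarrow> P q \<Longrightarrow> P (p + q)"
  shows "P (p :: 'w \<Rightarrow>\<^sub>0 'r::comm_ring_1)"
  using assms(1)
proof (induction p rule: Poly_Mapping.update_induct)
  case (update f w c)
  then have "Poly_Mapping.update w c f = f + Poly_Mapping.single w c"
    by (intro poly_mapping_eqI) (auto simp: lookup_update lookup_add lookup_single in_keys_iff when_def)
  moreover have "Poly_Mapping.keys f \<subseteq> A" "w \<in> A"
    using update by (auto simp: keys_update)
  ultimately show ?case
    using update assms(3,4) keys_single_subset by metis
qed (use assms(2) in simp)

text \<open>Scalars sit on the empty word, which is neutral for concatenation on both sides.\<close>
lemma scalar_central:
  "Poly_Mapping.single [] c * p = p * Poly_Mapping.single [] (c :: 'r::comm_ring_1)"
proof -
  have "Poly_Mapping.keys p \<subseteq> UNIV" by simp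
  then show ?thesis
    by (induction p rule: keys_subset_induct)
       (simp_all add: single_mult_single_list algebra_simps)
qed

lemma lookup_scalar_mult:
  "Poly_Mapping.lookup (Poly_Mapping.single [] c * p) w = c * Poly_Mapping.lookup p w"
  for c :: "'r::comm_ring_1"
proof -
  have "Poly_Mapping.single [] c * p = Poly_Mapping.map ((*) c) p"
    by (simp add: mult_map_scale_conv_mult zero_list_def)
  then show ?thesis by (simp add: Poly_Mapping.map.rep_eq when_def)
qed

lemma free_algebra_unital_algebra: "unital_algebra (free_algebra S :: ('r::comm_ring_1, 'm list \<Rightarrow>\<^sub>0 'r) module)"
proof -
  let ?F = "free_algebra S :: ('r, 'm list \<Rightarrow>\<^sub>0 'r) module"
  have add: "Poly_Mapping.keys (p + q) \<subseteq> lists S"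
    if "Poly_Mapping.keys p \<subseteq> lists S" "Poly_Mapping.keys q \<subseteq> lists S" for p q :: "'m list \<Rightarrow>\<^sub>0 'r"
    using that keys_add[of p q] by blast
  have group: "abelian_group ?F"
  proof (rule abelian_groupI)
    fix p assume "p \<in> carrier ?F"
    then show "\<exists>q\<in>carrier ?F. q \<oplus>\<^bsub>?F\<^esub> p = \<zero>\<^bsub>?F\<^esub>"
      by (intro bexI[of _ "- p"]) (auto simp: keys_uminus)
  qed (simp_all add: add add.assoc add.commute)
  have monoid: "Group.monoid ?F"
    by (rule monoidI) (simp_all add: keys_mult_lists mult.assoc zero_list_def)
  have ring: "ring ?F"
    by (intro ringI group monoid) (simp_all add: distrib_left distrib_right)
  have module: "module ground ?F"
  proof (rule moduleI)
    show "cring (ground :: 'r ring)" by (rule cring_from_type_algebra)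
  qed (simp_all add: group keys_mult_lists distrib_left distrib_right single_add flip: one_list
      mult.assoc single_mult_single_list[of "[]" _ "[]", simplified])
  show ?thesis
    by (intro unital_algebra.intro unital_algebra_axioms.intro module ring)
       (simp_all add: mult.assoc scalar_central)
qed

text \<open>The linear extension of a function on words; \<open>tensor_lift\<close> is this map applied to a chosen
  representative.\<close>
definition lin_ext :: "('r::comm_ring_1, 'v) module \<Rightarrow> ('w \<Rightarrow> 'v) \<Rightarrow> ('w \<Rightarrow>\<^sub>0 'r) \<Rightarrow> 'v" where
  "lin_ext V h p = (\<Oplus>\<^bsub>V\<^esub>w\<in>Poly_Mapping.keys p. Poly_Mapping.lookup p w \<odot>\<^bsub>V\<^esub> h w)"

text \<open>Enlarging the index set of the sum allows two elements with different supports to be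
  compared.\<close>
lemma lin_ext_superset:
  assumes "module ground V" "finite K" "Poly_Mapping.keys p \<subseteq> K" "\<And>w. w \<in> K \<Longrightarrow> h w \<in> carrier V"
  shows "lin_ext V h p = (\<Oplus>\<^bsub>V\<^esub>w\<in>K. Poly_Mapping.lookup p w \<odot>\<^bsub>V\<^esub> h w)"
proof -
  interpret V: module ground V by fact
  have "0 \<odot>\<^bsub>V\<^esub> h w = \<zero>\<^bsub>V\<^esub>" if "w \<in> K" for w
    using V.smult_l_null[OF assms(4)[OF that]] by simp
  then show ?thesis
    unfolding lin_ext_def using assms
    by (intro V.add.finprod_mono_neutral_cong_left) (auto simp: in_keys_iff)
qed

lemma lin_ext_single:
  assumes "module ground V" "h w \<in> carrier V"
  shows "lin_ext V h (Poly_Mapping.single w c) = c \<odot>\<^bsub>V\<^esub> h w"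
proof -
  interpret V: module ground V by fact
  have "lin_ext V h (Poly_Mapping.single w c) =
      (\<Oplus>\<^bsub>V\<^esub>w'\<in>{w}. Poly_Mapping.lookup (Poly_Mapping.single w c) w' \<odot>\<^bsub>V\<^esub> h w')"
    using assms by (intro lin_ext_superset keys_single_subset) auto
  then show ?thesis using assms by simp
qed

lemma lin_ext_linear:
  fixes V :: "('r::comm_ring_1, 'v) module" and S :: "'m set"
  assumes "module ground V" "\<And>w. w \<in> lists S \<Longrightarrow> h w \<in> carrier V"
  shows "linear_map (free_algebra S) V (lin_ext V h)"
proof -
  interpret V: module ground V by fact
  show ?thesis
  proof (rule linear_mapI)
    fix p :: "'m list \<Rightarrow>\<^sub>0 'r" assume p: "p \<in> carrier (free_algebra S)"
    have h: "h w \<in> carrier V" if "w \<in> Poly_Mapping.keys p" for w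
      using that p by (intro assms(2)) (simp, blast)
    then show "lin_ext V h p \<in> carrier V" by (auto simp: lin_ext_def)
    fix c
    have sub: "Poly_Mapping.keys (Poly_Mapping.single [] c * p) \<subseteq> Poly_Mapping.keys p"
      by (auto simp: in_keys_iff lookup_scalar_mult)
    have "lin_ext V h (c \<odot>\<^bsub>free_algebra S\<^esub> p) =
        (\<Oplus>\<^bsub>V\<^esub>w\<in>Poly_Mapping.keys p. (c * Poly_Mapping.lookup p w) \<odot>\<^bsub>V\<^esub> h w)"
      using lin_ext_superset[OF assms(1) finite_keys sub h] by (simp add: lookup_scalar_mult)
    also have "\<dots> = (\<Oplus>\<^bsub>V\<^esub>w\<in>Poly_Mapping.keys p. c \<odot>\<^bsub>V\<^esub> (Poly_Mapping.lookup p w \<odot>\<^bsub>V\<^esub> h w))"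
      using h V.smult_assoc1 by (intro V.finsum_cong') auto
    also have "\<dots> = c \<odot>\<^bsub>V\<^esub> lin_ext V h p"
      unfolding lin_ext_def using h by (intro V.finsum_smult[symmetric]) auto
    finally show "lin_ext V h (c \<odot>\<^bsub>free_algebra S\<^esub> p) = c \<odot>\<^bsub>V\<^esub> lin_ext V h p" .
  next
    fix p q :: "'m list \<Rightarrow>\<^sub>0 'r"
    assume pq: "p \<in> carrier (free_algebra S)" "q \<in> carrier (free_algebra S)"
    define K where "K = Poly_Mapping.keys p \<union> Poly_Mapping.keys q"
    have h: "h w \<in> carrier V" if "w \<in> K" for w
      using that pq unfolding K_def by (intro assms(2)) (simp, blast)
    have K: "finite K" "Poly_Mapping.keys p \<subseteq> K" "Poly_Mapping.keys q \<subseteq> K"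
        "Poly_Mapping.keys (p + q) \<subseteq> K"
      using keys_add[of p q] by (auto simp: K_def)
    have "(\<Oplus>\<^bsub>V\<^esub>w\<in>K. Poly_Mapping.lookup (p + q) w \<odot>\<^bsub>V\<^esub> h w) =
        (\<Oplus>\<^bsub>V\<^esub>w\<in>K. Poly_Mapping.lookup p w \<odot>\<^bsub>V\<^esub> h w \<oplus>\<^bsub>V\<^esub> Poly_Mapping.lookup q w \<odot>\<^bsub>V\<^esub> h w)"
      using h V.smult_l_distr by (intro V.finsum_cong') (auto simp: lookup_add)
    also have "\<dots> = (\<Oplus>\<^bsub>V\<^esub>w\<in>K. Poly_Mapping.lookup p w \<odot>\<^bsub>V\<^esub> h w) \<oplus>\<^bsub>V\<^esub>
        (\<Oplus>\<^bsub>V\<^esub>w\<in>K. Poly_Mapping.lookup q w \<odot>\<^bsub>V\<^esub> h w)"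
      using h by (intro V.finsum_addf) auto
    finally show "lin_ext V h (p \<oplus>\<^bsub>free_algebra S\<^esub> q) = lin_ext V h p \<oplus>\<^bsub>V\<^esub> lin_ext V h q"
      using lin_ext_superset[OF assms(1) K(1) _ h] K(2-4) by simp
  qed
qed

lemma linear_map_ext_free:
  fixes V :: "('r::comm_ring_1, 'v) module" and S :: "'m set"
  assumes "module ground V" "linear_map (free_algebra S) V f" "linear_map (free_algebra S) V g"
    and "\<And>w c. w \<in> lists S \<Longrightarrow> f (Poly_Mapping.single w c) = g (Poly_Mapping.single w c)"
    and "p \<in> carrier (free_algebra S)"
  shows "f p = g p"
proof -
  interpret F: unital_algebra "free_algebra S :: ('r, 'm list \<Rightarrow>\<^sub>0 'r) module"
    by (rule free_algebra_unital_algebra)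
  have "Poly_Mapping.keys p \<subseteq> lists S" using assms(5) by simp
  then show ?thesis
  proof (induction p rule: keys_subset_induct)
    case zero
    show ?case
      using linear_map_zero[OF F.module_axioms assms(1,2)] linear_map_zero[OF F.module_axioms assms(1,3)]
      by simp
  next
    case (add p q)
    then show ?case
      using linear_mapD(2)[OF assms(2), of p q] linear_mapD(2)[OF assms(3), of p q] by simp
  qed (rule assms(4))
qed

lemma lin_ext_single_mult:
  fixes V :: "('r::comm_ring_1, 'v) module" and S :: "'m set"
  assumes V: "module ground V" and h: "\<And>w. w \<in> lists S \<Longrightarrow> h w \<in> carrier V"
    and u: "u \<in> lists S" and p: "Poly_Mapping.keys p \<subseteq> lists S"
  shows "lin_ext V h (Poly_Mapping.single u c * p) = c \<odot>\<^bsub>V\<^esub> lin_ext V (\<lambda>w. h (u @ w)) p"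
    and "lin_ext V h (p * Poly_Mapping.single u c) = c \<odot>\<^bsub>V\<^esub> lin_ext V (\<lambda>w. h (w @ u)) p"
proof -
  interpret V: module ground V by fact
  note lin = lin_ext_linear[OF V, of S]
  have "linear_map V V (\<lambda>v. c \<odot>\<^bsub>V\<^esub> v)"
    by (intro linear_mapI) (simp_all add: V.smult_r_distr mult.commute flip: V.smult_assoc1[simplified])
  note scale = linear_map_comp[OF lin this]
  have l: "linear_map (free_algebra S) (free_algebra S) (\<lambda>p. Poly_Mapping.single u c * p)"
    using u by (intro linear_mapI)
      (simp_all add: keys_mult_lists distrib_left scalar_central mult.assoc)
  have r: "linear_map (free_algebra S) (free_algebra S) (\<lambda>p. p * Poly_Mapping.single u c)"
    using u by (intro linear_mapI)
      (simp_all add: keys_mult_lists distrib_right mult.assoc)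
  show "lin_ext V h (Poly_Mapping.single u c * p) = c \<odot>\<^bsub>V\<^esub> lin_ext V (\<lambda>w. h (u @ w)) p"
    by (rule linear_map_ext_free[OF V linear_map_comp[OF l lin] scale])
       (use h u p in \<open>simp_all add: single_mult_single_list lin_ext_single[OF V]
         V.smult_assoc1[simplified]\<close>)
  show "lin_ext V h (p * Poly_Mapping.single u c) = c \<odot>\<^bsub>V\<^esub> lin_ext V (\<lambda>w. h (w @ u)) p"
    by (rule linear_map_ext_free[OF V linear_map_comp[OF r lin] scale])
       (use h u p in \<open>simp_all add: single_mult_single_list lin_ext_single[OF V] mult.commute
          flip: V.smult_assoc1[simplified]\<close>)
qed


section \<open>The universal property of the tensor algebra\<close>

definition multilinear ::
  "('r::comm_ring_1, 'm) module \<Rightarrow> ('r, 'v) module \<Rightarrow> ('m list \<Rightarrow> 'v) \<Rightarrow> bool" where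
  "multilinear M V h \<longleftrightarrow>
     (\<forall>w\<in>lists (carrier M). h w \<in> carrier V) \<and>
     (\<forall>u\<in>lists (carrier M). \<forall>v\<in>lists (carrier M). linear_map M V (\<lambda>x. h (u @ x # v)))"

lemma multilinearD:
  assumes "multilinear M V h"
  shows "w \<in> lists (carrier M) \<Longrightarrow> h w \<in> carrier V"
    and "u \<in> lists (carrier M) \<Longrightarrow> v \<in> lists (carrier M) \<Longrightarrow>
      linear_map M V (\<lambda>x. h (u @ x # v))"
  using assms by (auto simp: multilinear_def)

lemma free_algebra_minus:
  assumes "p \<in> carrier (free_algebra S)" "q \<in> carrier (free_algebra S)"
  shows "p \<ominus>\<^bsub>free_algebra S\<^esub> q = p - (q :: 'm list \<Rightarrow>\<^sub>0 'r::comm_ring_1)"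
proof -
  interpret F: unital_algebra "free_algebra S :: ('r, 'm list \<Rightarrow>\<^sub>0 'r) module"
    by (rule free_algebra_unital_algebra)
  have "\<ominus>\<^bsub>free_algebra S\<^esub> q = - q"
    using assms(2) by (intro F.minus_equality) (simp_all add: keys_uminus)
  then show ?thesis by (simp add: a_minus_def)
qed

text \<open>The form in which a linear map is shown to kill a relation \<open>p - q\<close>.\<close>
lemma linear_map_diff:
  assumes V: "module ground V" and f: "linear_map (free_algebra S) V f"
    and p: "p \<in> carrier (free_algebra S)" and q: "q \<in> carrier (free_algebra S)"
    and eq: "f p = f q"
  shows "f (p - q) = \<zero>\<^bsub>V\<^esub>"
proof -
  interpret V: module ground V by fact
  interpret F: unital_algebra "free_algebra S"
    by (rule free_algebra_unital_algebra)
  have d: "p - q \<in> carrier (free_algebra S)"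
    using F.minus_closed[OF p q] by (simp only: free_algebra_minus[OF p q])
  have "f p = f (p - q) \<oplus>\<^bsub>V\<^esub> f q"
    using linear_mapD(2)[OF f d q] by simp
  then show ?thesis
    using V.add.r_cancel_one'[OF linear_mapD(1)[OF f q] linear_mapD(1)[OF f d]] eq by simp
qed

context
  fixes M :: "('r::comm_ring_1, 'm) module"
  assumes M: "module ground M"
begin

interpretation M: module ground M by (fact M)
interpretation F: unital_algebra "free_algebra (carrier M) :: ('r, 'm list \<Rightarrow>\<^sub>0 'r) module"
  by (rule free_algebra_unital_algebra)

lemma smult_carrier [simp]: "x \<in> carrier M \<Longrightarrow> c \<odot>\<^bsub>M\<^esub> x \<in> carrier M"
  by (rule M.smult_closed) simp_all

abbreviation (input) "tensor_relations \<equiv>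
  {Poly_Mapping.single [x \<oplus>\<^bsub>M\<^esub> y] 1 - Poly_Mapping.single [x] 1 - Poly_Mapping.single [y] (1::'r)
     | x y. x \<in> carrier M \<and> y \<in> carrier M} \<union>
  {Poly_Mapping.single [c \<odot>\<^bsub>M\<^esub> x] 1 - Poly_Mapping.single [x] c | c x. x \<in> carrier M}"

lemma tensor_relations_subset: "tensor_relations \<subseteq> carrier (free_algebra (carrier M))"
proof -
  have *: "Poly_Mapping.keys (p - q) \<subseteq> lists (carrier M)"
    if "Poly_Mapping.keys p \<subseteq> lists (carrier M)" "Poly_Mapping.keys q \<subseteq> lists (carrier M)"
    for p q :: "'m list \<Rightarrow>\<^sub>0 'r"
    using that keys_diff[of p q] by blast
  show ?thesis
    by (intro subsetI, elim UnE CollectE exE conjE) (simp_all add: *)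
qed

lemma tensor_ideal_ideal: "ideal (tensor_ideal M) (free_algebra (carrier M))"
  unfolding tensor_ideal_def by (rule F.genideal_ideal[OF tensor_relations_subset])

text \<open>
  The elements that the extension of \<open>h\<close> kills need not form a two-sided ideal. Those that are killed
  whatever words \<open>u\<close> and \<open>v\<close> are put around them do, and multilinearity of \<open>h\<close> says that the
  defining relations of the tensor algebra are among them.
\<close>
lemma lin_ext_tensor_ideal:
  fixes V :: "('r, 'v) module"
  assumes V: "module ground V" and h: "multilinear M V h" and p: "p \<in> tensor_ideal M"
  shows "lin_ext V h p = \<zero>\<^bsub>V\<^esub>"
proof -
  interpret V: module ground V by fact
  let ?L = "lists (carrier M)" and ?F = "free_algebra (carrier M) :: ('r, 'm list \<Rightarrow>\<^sub>0 'r) module"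
  define K where "K = {p \<in> carrier ?F. \<forall>u\<in>?L. \<forall>v\<in>?L. lin_ext V (\<lambda>w. h (u @ w @ v)) p = \<zero>\<^bsub>V\<^esub>}"
  have hc: "h (u @ w @ v) \<in> carrier V" if "u \<in> ?L" "v \<in> ?L" "w \<in> ?L" for u v w
    using that by (intro multilinearD(1)[OF h]) simp
  have lin: "linear_map ?F V (lin_ext V (\<lambda>w. h (u @ w @ v)))" if "u \<in> ?L" "v \<in> ?L" for u v
    using that hc by (intro lin_ext_linear V) blast
  have "ideal K ?F"
  proof (rule F.idealI_closed)
    show "\<zero>\<^bsub>?F\<^esub> \<in> K"
      by (simp add: K_def lin_ext_def)
    show "p \<oplus>\<^bsub>?F\<^esub> q \<in> K" if "p \<in> K" "q \<in> K" for p q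
      using that F.a_closed[of p q] linear_mapD(2)[OF lin, of _ _ p q] by (auto simp: K_def)
    show "q \<otimes>\<^bsub>?F\<^esub> p \<in> K" if q: "q \<in> carrier ?F" and p: "p \<in> K" for p q
    proof -
      have "lin_ext V (\<lambda>w. h (u @ w @ v)) (q * p) = \<zero>\<^bsub>V\<^esub>" if uv: "u \<in> ?L" "v \<in> ?L" for u v
      proof -
        have pK: "lin_ext V (\<lambda>w. h (u @ w @ v)) p = \<zero>\<^bsub>V\<^esub>" if "u \<in> ?L" "v \<in> ?L" for u v
          using p that unfolding K_def by blast
        have "Poly_Mapping.keys q \<subseteq> ?L" using q by simp
        then show ?thesis
        proof (induction q rule: keys_subset_induct)
          case (single w c)
          then show ?case
            using pK[of "u @ w" v] uv hc[OF uv] p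
            by (subst lin_ext_single_mult[OF V, of "carrier M"]) (simp_all add: K_def)
        next
          case (add q q')
          then show ?case
            using p linear_mapD(2)[OF lin[OF uv], of "q * p" "q' * p"]
            by (simp add: K_def keys_mult_lists distrib_right)
        qed (simp add: lin_ext_def)
      qed
      then show ?thesis using p q by (simp add: K_def keys_mult_lists)
    qed
    show "p \<otimes>\<^bsub>?F\<^esub> q \<in> K" if q: "q \<in> carrier ?F" and p: "p \<in> K" for p q
    proof -
      have "lin_ext V (\<lambda>w. h (u @ w @ v)) (p * q) = \<zero>\<^bsub>V\<^esub>" if uv: "u \<in> ?L" "v \<in> ?L" for u v
      proof -
        have pK: "lin_ext V (\<lambda>w. h (u @ w @ v)) p = \<zero>\<^bsub>V\<^esub>" if "u \<in> ?L" "v \<in> ?L" for u v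
          using p that unfolding K_def by blast
        have "Poly_Mapping.keys q \<subseteq> ?L" using q by simp
        then show ?thesis
        proof (induction q rule: keys_subset_induct)
          case (single w c)
          then show ?case
            using pK[of u "w @ v"] uv hc[OF uv] p
            by (subst lin_ext_single_mult[OF V, of "carrier M"]) (simp_all add: K_def)
        next
          case (add q q')
          then show ?case
            using p linear_mapD(2)[OF lin[OF uv], of "p * q" "p * q'"]
            by (simp add: K_def keys_mult_lists distrib_left)
        qed (simp add: lin_ext_def)
      qed
      then show ?thesis using p q by (simp add: K_def keys_mult_lists)
    qed
  qed (auto simp: K_def)
  moreover have "tensor_relations \<subseteq> K"
  proof
    fix p assume p: "p \<in> tensor_relations"
    have "lin_ext V (\<lambda>w. h (u @ w @ v)) p = \<zero>\<^bsub>V\<^esub>" if uv: "u \<in> ?L" "v \<in> ?L" for u v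
    proof -
      let ?l = "lin_ext V (\<lambda>w. h (u @ w @ v))"
      have s: "?l (Poly_Mapping.single [x] c) = c \<odot>\<^bsub>V\<^esub> h (u @ x # v)" if "x \<in> carrier M" for x c
        using hc[OF uv, of "[x]"] that by (subst lin_ext_single[OF V]) simp_all
      have hx: "h (u @ x # v) \<in> carrier V" if "x \<in> carrier M" for x
        using hc[OF uv, of "[x]"] that by simp
      note hl = linear_mapD(2,3)[OF multilinearD(2)[OF h uv]]
      from p consider (add) x y where "x \<in> carrier M" "y \<in> carrier M"
          "p = Poly_Mapping.single [x \<oplus>\<^bsub>M\<^esub> y] 1 -
             (Poly_Mapping.single [x] 1 + Poly_Mapping.single [y] 1)"
        | (smult) c x where "x \<in> carrier M"
          "p = Poly_Mapping.single [c \<odot>\<^bsub>M\<^esub> x] 1 - Poly_Mapping.single [x] c"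
        by (auto simp: diff_diff_eq)
      then show ?thesis
      proof cases
        case add
        let ?x = "Poly_Mapping.single [x] (1::'r)" and ?y = "Poly_Mapping.single [y] (1::'r)"
        have c: "?x \<in> carrier ?F" "?y \<in> carrier ?F" using add by simp_all
        have "?l (?x + ?y) = ?l ?x \<oplus>\<^bsub>V\<^esub> ?l ?y"
          using linear_mapD(2)[OF lin[OF uv] c] by simp
        moreover have "?x + ?y \<in> carrier ?F"
          using F.a_closed[OF c] by simp
        ultimately show ?thesis
          unfolding add(3) using add hl hx V.smult_one
          by (intro linear_map_diff[OF V lin[OF uv]]) (simp_all add: s)
      next
        case smult
        then show ?thesis
          unfolding smult(2) using hl hx V.smult_one
          by (intro linear_map_diff[OF V lin[OF uv]]) (simp_all add: s)
      qed
    qed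
    then show "p \<in> K"
      using p tensor_relations_subset unfolding K_def by blast
  qed
  ultimately have "tensor_ideal M \<subseteq> K"
    unfolding tensor_ideal_def by (rule F.genideal_minimal)
  then have "lin_ext V (\<lambda>w. h ([] @ w @ [])) p = \<zero>\<^bsub>V\<^esub>"
    using p unfolding K_def by blast
  then show ?thesis by simp
qed

lemma tensor_algebra_unital_algebra: "unital_algebra (tensor_algebra M)"
  unfolding tensor_algebra_def by (rule F.quotient_unital_algebra[OF tensor_ideal_ideal])

interpretation T: unital_algebra "tensor_algebra M"
  by (rule tensor_algebra_unital_algebra)

lemmas tensor_algebra_quotient =
  F.quotient_carrier[of "tensor_ideal M", folded tensor_algebra_def]
  F.quotient_add[OF tensor_ideal_ideal, folded tensor_algebra_def]
  F.quotient_mult[OF tensor_ideal_ideal, folded tensor_algebra_def]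
  F.quotient_smult[OF tensor_ideal_ideal, folded tensor_algebra_def]

lemma tensor_closed [simp]: "w \<in> lists (carrier M) \<Longrightarrow> tensor M w \<in> carrier (tensor_algebra M)"
  by (auto simp: tensor_algebra_quotient tensor_def)

lemma tensor_append:
  assumes "u \<in> lists (carrier M)" "v \<in> lists (carrier M)"
  shows "tensor M (u @ v) = tensor M u \<otimes>\<^bsub>tensor_algebra M\<^esub> tensor M v"
  using assms by (simp add: tensor_def tensor_algebra_quotient single_mult_single_list)

lemma smult_tensor:
  assumes "w \<in> lists (carrier M)"
  shows "c \<odot>\<^bsub>tensor_algebra M\<^esub> tensor M w =
    tensor_ideal M +>\<^bsub>free_algebra (carrier M)\<^esub> Poly_Mapping.single w c"
  using assms by (simp add: tensor_def tensor_algebra_quotient single_mult_single_list)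

lemma tensor_linear: "linear_map M (tensor_algebra M) (\<lambda>x. tensor M [x])"
proof -
  let ?F = "free_algebra (carrier M) :: ('r, 'm list \<Rightarrow>\<^sub>0 'r) module"
  interpret J: ideal "tensor_ideal M" ?F by (rule tensor_ideal_ideal)
  have eq: "tensor_ideal M +>\<^bsub>?F\<^esub> p = tensor_ideal M +>\<^bsub>?F\<^esub> q"
    if "p - q \<in> tensor_relations" "p \<in> carrier ?F" "q \<in> carrier ?F" for p q
  proof -
    have "p - q \<in> tensor_ideal M"
      unfolding tensor_ideal_def using F.genideal_self[OF tensor_relations_subset] that(1) by blast
    then show ?thesis
      using F.quotient_eq_iff_same_a_r_cos[OF tensor_ideal_ideal that(2,3)]
        free_algebra_minus[OF that(2,3)] by simp
  qed
  show ?thesis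
  proof (rule linear_mapI)
    fix x y assume xy: "x \<in> carrier M" "y \<in> carrier M"
    have c: "Poly_Mapping.single [x] (1::'r) \<in> carrier ?F" "Poly_Mapping.single [y] (1::'r) \<in> carrier ?F"
      using xy by simp_all
    show "tensor M [x \<oplus>\<^bsub>M\<^esub> y] = tensor M [x] \<oplus>\<^bsub>tensor_algebra M\<^esub> tensor M [y]"
      unfolding tensor_def tensor_algebra_quotient(2)[OF c]
      using xy F.a_closed[OF c] by (intro eq) (auto simp: diff_diff_eq)
  next
    fix c x assume x: "x \<in> carrier M"
    show "tensor M [c \<odot>\<^bsub>M\<^esub> x] = c \<odot>\<^bsub>tensor_algebra M\<^esub> tensor M [x]"
    proof -
      have "tensor_ideal M +>\<^bsub>?F\<^esub> Poly_Mapping.single [c \<odot>\<^bsub>M\<^esub> x] 1 =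
          tensor_ideal M +>\<^bsub>?F\<^esub> Poly_Mapping.single [x] c"
        by (rule eq) (use x in auto)
      then show ?thesis
        using smult_tensor[of "[x]" c] x by (simp add: tensor_def)
    qed
  qed simp
qed

lemma tensor_multilinear: "multilinear M (tensor_algebra M) (tensor M)"
proof -
  have "linear_map M (tensor_algebra M) (\<lambda>x. tensor M (u @ x # v))"
    if uv: "u \<in> lists (carrier M)" "v \<in> lists (carrier M)" for u v
  proof -
    have "tensor M (u @ x # v) =
        tensor M u \<otimes>\<^bsub>tensor_algebra M\<^esub> (tensor M [x] \<otimes>\<^bsub>tensor_algebra M\<^esub> tensor M v)"
      if "x \<in> carrier M" for x
      using uv that tensor_append[of u "[x] @ v"] tensor_append[of "[x]" v] by simp
    then show ?thesis
      using uv linear_mapD[OF tensor_linear] M.a_closed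
      by (intro linear_mapI)
         (simp_all add: T.l_distr T.r_distr flip: T.smult_mult_left T.smult_mult_right)
  qed
  then show ?thesis by (simp add: multilinear_def)
qed

lemma tensor_lift_coset:
  assumes "module ground V" "multilinear M V h" "p \<in> carrier (free_algebra (carrier M))"
  shows "tensor_lift V h (tensor_ideal M +>\<^bsub>free_algebra (carrier M)\<^esub> p) = lin_ext V h p"
  unfolding tensor_lift_def Let_def lin_ext_def[symmetric]
  by (intro F.quotient_representative[OF tensor_ideal_ideal assms(1)]
      lin_ext_linear[OF assms(1) multilinearD(1)[OF assms(2)]] lin_ext_tensor_ideal[OF assms(1,2)] assms(3))

lemma tensor_lift_tensor:
  assumes "module ground V" "multilinear M V h" "w \<in> lists (carrier M)"
  shows "tensor_lift V h (tensor M w) = h w"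
proof -
  interpret V: module ground V by fact
  show ?thesis
    using assms multilinearD(1)[OF assms(2,3)] V.smult_one
    by (simp add: tensor_def tensor_lift_coset lin_ext_single)
qed

lemma tensor_lift_linear:
  assumes "module ground V" "multilinear M V h"
  shows "linear_map (tensor_algebra M) V (tensor_lift V h)"
proof -
  have "tensor_lift V h = (\<lambda>z. lin_ext V h (SOME p. p \<in> z))"
    by (simp add: tensor_lift_def lin_ext_def Let_def fun_eq_iff)
  then show ?thesis
    unfolding tensor_algebra_def
    by (simp add: F.linear_map_quotient[OF tensor_ideal_ideal assms(1)
        lin_ext_linear[OF assms(1) multilinearD(1)[OF assms(2)]] lin_ext_tensor_ideal[OF assms]])
qed

text \<open>Identities on the tensor algebra that are linear in an argument need only be verified on pure
  tensors.\<close>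
lemma linear_map_ext_tensor:
  assumes V: "module ground V"
    and f: "linear_map (tensor_algebra M) V f" and g: "linear_map (tensor_algebra M) V g"
    and eq: "\<And>w. w \<in> lists (carrier M) \<Longrightarrow> f (tensor M w) = g (tensor M w)"
    and z: "z \<in> carrier (tensor_algebra M)"
  shows "f z = g z"
proof -
  let ?F = "free_algebra (carrier M) :: ('r, 'm list \<Rightarrow>\<^sub>0 'r) module"
  have pr: "linear_map ?F (tensor_algebra M) (\<lambda>p. tensor_ideal M +>\<^bsub>?F\<^esub> p)"
    using tensor_algebra_quotient by (intro linear_mapI) simp_all
  obtain p where p: "p \<in> carrier ?F" "z = tensor_ideal M +>\<^bsub>?F\<^esub> p"
    using z by (auto simp only: tensor_algebra_quotient)
  have "f (tensor_ideal M +>\<^bsub>?F\<^esub> p) = g (tensor_ideal M +>\<^bsub>?F\<^esub> p)"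
  proof (rule linear_map_ext_free[OF V linear_map_comp[OF pr f] linear_map_comp[OF pr g] _ p(1)])
    fix w c assume "w \<in> lists (carrier M)"
    then show "f (tensor_ideal M +>\<^bsub>?F\<^esub> Poly_Mapping.single w c) =
        g (tensor_ideal M +>\<^bsub>?F\<^esub> Poly_Mapping.single w c)"
      using linear_mapD(3)[OF f] linear_mapD(3)[OF g] eq by (simp flip: smult_tensor)
  qed
  then show ?thesis using p by simp
qed

end

lemma tensor_bilinear:
  assumes "module ground M"
  shows "bilinear_map M M (tensor_algebra M) (\<lambda>x y. tensor M [x, y])"
  using multilinearD(2)[OF tensor_multilinear[OF assms], of "[]" "[y]" for y]
    multilinearD(2)[OF tensor_multilinear[OF assms], of "[x]" "[]" for x]
  by (intro bilinear_mapI) simp_all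

text \<open>A bilinear map as a function on words, so that \<open>tensor_lift\<close> turns it into a linear map on the
  tensor algebra that lives on degree 2.\<close>
definition on_pairs :: "('r::comm_ring_1, 'v) module \<Rightarrow> ('m \<Rightarrow> 'm \<Rightarrow> 'v) \<Rightarrow> 'm list \<Rightarrow> 'v" where
  "on_pairs V f w = (case w of [x, y] \<Rightarrow> f x y | _ \<Rightarrow> \<zero>\<^bsub>V\<^esub>)"

lemma on_pairs_other: "length w \<noteq> 2 \<Longrightarrow> on_pairs V f w = \<zero>\<^bsub>V\<^esub>"
  by (auto simp: on_pairs_def split: list.split)

lemma on_pairs_multilinear:
  assumes V: "module ground V" and f: "bilinear_map M M V f"
  shows "multilinear M V (on_pairs V f)"
proof -
  interpret V: module ground V by fact
  have "on_pairs V f w \<in> carrier V" if "w \<in> lists (carrier M)" for w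
    using that f by (auto simp: on_pairs_def bilinear_map_def split: list.split)
  moreover have "linear_map M V (\<lambda>x. on_pairs V f (u @ x # v))"
    if "u \<in> lists (carrier M)" "v \<in> lists (carrier M)" for u v
  proof -
    have "length u = 0 \<and> length v = 1 \<or> length u = 1 \<and> length v = 0 \<or> length u + length v \<noteq> 1"
      by linarith
    then consider (left) y where "u = []" "v = [y]" | (right) x where "u = [x]" "v = []"
      | (other) "length u + length v \<noteq> 1"
      by (auto simp: length_Suc_conv)
    then show ?thesis
    proof cases
      case left
      then show ?thesis using bilinear_map_linear(1)[OF f, of y] that by (simp add: on_pairs_def)
    next
      case right
      then show ?thesis using bilinear_map_linear(2)[OF f, of x] that by (simp add: on_pairs_def)
    next
      case other
      then have "on_pairs V f (u @ x # v) = \<zero>\<^bsub>V\<^esub>" for x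
        using on_pairs_other[of "u @ x # v"] by simp
      then show ?thesis by (simp add: linear_map_const_zero[OF V])
    qed
  qed
  ultimately show ?thesis by (simp add: multilinear_def)
qed

lemma multilinear_cong:
  assumes "\<And>w. w \<in> lists (carrier M) \<Longrightarrow> h w = h' w" "module ground M"
  shows "multilinear M V h \<longleftrightarrow> multilinear M V h'"
proof -
  interpret M: module ground M by fact
  have "linear_map M V (\<lambda>x. h (u @ x # v)) \<longleftrightarrow> linear_map M V (\<lambda>x. h' (u @ x # v))"
    if "u \<in> lists (carrier M)" "v \<in> lists (carrier M)" for u v
    using that assms(1) M.smult_closed by (simp add: linear_map_def)
  then show ?thesis using assms(1) by (simp add: multilinear_def)
qed

lemma finsum_tensor_power:
  assumes M: "module ground M" and z: "\<And>i. i \<in> I \<Longrightarrow> z i \<in> tensor_power M k"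
  shows "(\<Oplus>\<^bsub>tensor_algebra M\<^esub>i\<in>I. z i) \<in> tensor_power M k"
proof -
  interpret F: unital_algebra "free_algebra (carrier M)"
    by (rule free_algebra_unital_algebra)
  interpret J: ideal "tensor_ideal M" "free_algebra (carrier M)" by (rule tensor_ideal_ideal[OF M])
  interpret T: unital_algebra "tensor_algebra M" by (rule tensor_algebra_unital_algebra[OF M])
  have zero: "\<zero>\<^bsub>tensor_algebra M\<^esub> \<in> tensor_power M k"
    unfolding tensor_power_def
    using F.a_coset_add_zero[OF J.a_subset]
    by (intro CollectI exI[of _ 0]) (simp add: tensor_algebra_def)
  have add: "x \<oplus>\<^bsub>tensor_algebra M\<^esub> y \<in> tensor_power M k"
    if "x \<in> tensor_power M k" "y \<in> tensor_power M k" for x y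
  proof -
    let ?F = "free_algebra (carrier M)"
    obtain p q where p: "p \<in> carrier ?F" "\<forall>w\<in>Poly_Mapping.keys p. length w = k"
        "x = tensor_ideal M +>\<^bsub>?F\<^esub> p"
      and q: "q \<in> carrier ?F" "\<forall>w\<in>Poly_Mapping.keys q. length w = k"
        "y = tensor_ideal M +>\<^bsub>?F\<^esub> q"
      using \<open>x \<in> _\<close> \<open>y \<in> _\<close> unfolding tensor_power_def by blast
    have "x \<oplus>\<^bsub>tensor_algebra M\<^esub> y = tensor_ideal M +>\<^bsub>?F\<^esub> (p + q)"
      using tensor_algebra_quotient(2)[OF M p(1) q(1)] by (simp add: p(3) q(3))
    moreover have "p + q \<in> carrier ?F" using F.a_closed[OF p(1) q(1)] by simp
    moreover have "\<forall>w\<in>Poly_Mapping.keys (p + q). length w = k"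
      using p(2) q(2) keys_add[of p q] by blast
    ultimately show ?thesis unfolding tensor_power_def by blast
  qed
  have sub: "tensor_power M k \<subseteq> carrier (tensor_algebra M)"
    unfolding tensor_power_def tensor_algebra_quotient(1)[OF M] by blast
  show ?thesis
    using z
  proof (induction I rule: infinite_finite_induct)
    case (insert i I)
    then have "(\<Oplus>\<^bsub>tensor_algebra M\<^esub>i\<in>insert i I. z i) =
        z i \<oplus>\<^bsub>tensor_algebra M\<^esub> (\<Oplus>\<^bsub>tensor_algebra M\<^esub>i\<in>I. z i)"
      using sub by (intro T.finsum_insert) auto
    then show ?case using insert add by simp
  qed (simp_all add: zero)
qed

lemma smult_tensor_in_tensor_power:
  assumes M: "module ground M" and w: "w \<in> lists (carrier M)" "length w = k"
  shows "c \<odot>\<^bsub>tensor_algebra M\<^esub> tensor M w \<in> tensor_power M k"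
  unfolding tensor_power_def smult_tensor[OF M w(1)]
  using w by (intro CollectI exI[of _ "Poly_Mapping.single w c"]) auto

text \<open>
  Applying \<open>k\<close> to the entries of a word one at a time and adding the results: each summand is
  linear in each letter, whether or not that letter is the one hit by \<open>k\<close>. This is the extension
  of \<open>k\<close> to a derivation of the tensor algebra.
\<close>
lemma derivation_multilinear:
  assumes M: "module ground M" and k: "linear_map M M k"
  shows "multilinear M (tensor_algebra M)
    (\<lambda>w. \<Oplus>\<^bsub>tensor_algebra M\<^esub>i\<in>{..<length w}. tensor M (w[i := k (w ! i)]))"
proof -
  interpret M: module ground M by fact
  interpret T: unital_algebra "tensor_algebra M" by (rule tensor_algebra_unital_algebra[OF M])
  note closed = multilinearD(1)[OF tensor_multilinear[OF M]]
  note lin = multilinearD(2)[OF tensor_multilinear[OF M]]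
  have upd: "w[i := k (w ! i)] \<in> lists (carrier M)" if "w \<in> lists (carrier M)" "i < length w" for w i
  proof -
    have "set w \<subseteq> carrier M" using that(1) by auto
    moreover have "k (w ! i) \<in> carrier M"
      using calculation nth_mem[OF that(2)] by (intro linear_mapD(1)[OF k]) blast
    ultimately have "set (w[i := k (w ! i)]) \<subseteq> carrier M"
      by (intro set_update_subsetI)
    then show ?thesis by auto
  qed
  show ?thesis
    unfolding multilinear_def
  proof (intro conjI ballI)
    show "(\<Oplus>\<^bsub>tensor_algebra M\<^esub>i\<in>{..<length w}. tensor M (w[i := k (w ! i)])) \<in> carrier (tensor_algebra M)"
      if "w \<in> lists (carrier M)" for w
      using that upd closed by (intro T.finsum_closed) auto
  next
    fix u v assume uv: "u \<in> lists (carrier M)" "v \<in> lists (carrier M)"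
    have "linear_map M (tensor_algebra M) (\<lambda>x. tensor M ((u @ x # v)[i := k ((u @ x # v) ! i)]))"
      if "i < Suc (length u + length v)" for i
    proof -
      have "i < length u \<or> i = length u \<or>
            (i = Suc (length u + (i - Suc (length u))) \<and> i - Suc (length u) < length v)"
        using that by linarith
      then consider "i < length u" | "i = length u" | j where "i = Suc (length u + j)" "j < length v"
        by blast
      then show ?thesis
      proof cases
        case 1
        then show ?thesis
          using lin[OF upd[OF uv(1) 1] uv(2)] by (simp add: list_update_append nth_append)
      next
        case 2
        then show ?thesis
          using linear_map_comp[OF k lin[OF uv]] by simp
      next
        case 3
        then show ?thesis
          using lin[OF uv(1) upd[OF uv(2) 3(2)]] by (simp add: list_update_append nth_append)
      qed
    qed
    then have "linear_map M (tensor_algebra M)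
        (\<lambda>x. \<Oplus>\<^bsub>tensor_algebra M\<^esub>i\<in>{..<Suc (length u + length v)}.
          tensor M ((u @ x # v)[i := k ((u @ x # v) ! i)]))"
      by (intro linear_map_finsum_fun[OF T.module_axioms]) (simp only: lessThan_iff)
    then show "linear_map M (tensor_algebra M) (\<lambda>x. \<Oplus>\<^bsub>tensor_algebra M\<^esub>i\<in>{..<length (u @ x # v)}.
        tensor M ((u @ x # v)[i := k ((u @ x # v) ! i)]))"
      by simp
  qed
qed


section \<open>The action of the enveloping algebra\<close>

text \<open>Modules over the Lie algebra, to which the enveloping algebra extends the action.\<close>
definition lie_action ::
  "('r::comm_ring_1, 'g) module \<Rightarrow> ('g \<Rightarrow> 'g \<Rightarrow> 'g) \<Rightarrow> ('r, 'a) module \<Rightarrow> ('g \<Rightarrow> 'a \<Rightarrow> 'a) \<Rightarrow> bool" where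
  "lie_action G br A act \<longleftrightarrow> module ground A \<and> bilinear_map G A A act \<and>
     (\<forall>x\<in>carrier G. \<forall>y\<in>carrier G. \<forall>a\<in>carrier A.
        act (br x y) a = act x (act y a) \<ominus>\<^bsub>A\<^esub> act y (act x a))"

context
  fixes G :: "('r::comm_ring_1, 'g) module" and br :: "'g \<Rightarrow> 'g \<Rightarrow> 'g"
  assumes lie: "lie_algebra G br"
begin

lemma lie_module: "module ground G"
  using lie by (simp add: lie_algebra_def)

lemma br_closed: "x \<in> carrier G \<Longrightarrow> y \<in> carrier G \<Longrightarrow> br x y \<in> carrier G"
  using lie by (simp add: lie_algebra_def bilinear_map_def)

interpretation G: module ground G by (rule lie_module)
interpretation T: unital_algebra "tensor_algebra G"
  by (rule tensor_algebra_unital_algebra[OF lie_module])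

abbreviation (input) "enveloping_relations \<equiv>
  {tensor G [x, y] \<ominus>\<^bsub>tensor_algebra G\<^esub> tensor G [y, x] \<ominus>\<^bsub>tensor_algebra G\<^esub> tensor G [br x y]
     | x y. x \<in> carrier G \<and> y \<in> carrier G}"

lemma enveloping_relations_subset: "enveloping_relations \<subseteq> carrier (tensor_algebra G)"
  using br_closed by (auto simp: tensor_closed[OF lie_module])

lemma enveloping_ideal_ideal: "ideal (enveloping_ideal G br) (tensor_algebra G)"
  unfolding enveloping_ideal_def by (rule T.genideal_ideal[OF enveloping_relations_subset])

lemma enveloping_unital_algebra: "unital_algebra (enveloping_algebra G br)"
  unfolding enveloping_algebra_def by (rule T.quotient_unital_algebra[OF enveloping_ideal_ideal])

interpretation U: unital_algebra "enveloping_algebra G br"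
  by (rule enveloping_unital_algebra)

lemmas enveloping_quotient =
  T.quotient_carrier[of "enveloping_ideal G br", folded enveloping_algebra_def]
  T.quotient_add[OF enveloping_ideal_ideal, folded enveloping_algebra_def]
  T.quotient_mult[OF enveloping_ideal_ideal, folded enveloping_algebra_def]
  T.quotient_smult[OF enveloping_ideal_ideal, folded enveloping_algebra_def]

lemma enveloping_incl_closed [simp]:
  "x \<in> carrier G \<Longrightarrow> enveloping_incl G br x \<in> carrier (enveloping_algebra G br)"
  by (auto simp: enveloping_incl_def enveloping_quotient tensor_closed[OF lie_module])

text \<open>Equivariance of the inclusion of the enveloping algebra into its tensor algebra.\<close>
lemma tensor_enveloping_act_tensor:
  assumes x: "x \<in> carrier G" and u: "u \<in> carrier (enveloping_algebra G br)"
  shows "tensor_enveloping_act G br x (tensor (enveloping_algebra G br) [u]) =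
    tensor (enveloping_algebra G br) [enveloping_incl G br x \<otimes>\<^bsub>enveloping_algebra G br\<^esub> u]"
proof -
  let ?U = "enveloping_algebra G br" and ?x = "enveloping_incl G br x"
  interpret TU: unital_algebra "tensor_algebra ?U"
    by (rule tensor_algebra_unital_algebra[OF U.module_axioms])
  have xu: "?x \<otimes>\<^bsub>?U\<^esub> u \<in> carrier ?U" using x u by simp
  have "linear_map ?U ?U (\<lambda>u. ?x \<otimes>\<^bsub>?U\<^esub> u)"
    using x by (intro linear_mapI) (simp_all add: U.r_distr U.smult_mult_right)
  note ml = derivation_multilinear[OF U.module_axioms this]
  show ?thesis
    using tensor_lift_tensor[OF U.module_axioms TU.module_axioms ml, of "[u]"] u xu
      tensor_closed[OF U.module_axioms]
    by (simp add: tensor_enveloping_act_def Let_def lessThan_Suc TU.finsum_insert)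
qed

context
  fixes A :: "('r, 'a) module" and act :: "'g \<Rightarrow> 'a \<Rightarrow> 'a"
  assumes action: "lie_action G br A act"
begin

lemma act_module: "module ground A" and act_bilinear: "bilinear_map G A A act"
  using action by (simp_all add: lie_action_def)

interpretation A: module ground A by (rule act_module)

abbreviation (input) "tensor_act z a \<equiv> tensor_lift A (\<lambda>w. foldr act w a) z"

lemma foldr_act_linear: "w \<in> lists (carrier G) \<Longrightarrow> linear_map A A (foldr act w)"
proof (induction w)
  case (Cons x w)
  then show ?case
    using linear_map_comp[OF _ bilinear_map_linear(2)[OF act_bilinear, of x]] by (simp add: comp_def)
qed (simp add: linear_map_def)

lemma foldr_act_multilinear:
  assumes "a \<in> carrier A"
  shows "multilinear G A (\<lambda>w. foldr act w a)"
  unfolding multilinear_def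
proof (intro conjI ballI)
  fix u v assume uv: "u \<in> lists (carrier G)" "v \<in> lists (carrier G)"
  then have "foldr act v a \<in> carrier A"
    using linear_mapD(1)[OF foldr_act_linear] assms by blast
  then show "linear_map G A (\<lambda>x. foldr act (u @ x # v) a)"
    using linear_map_comp[OF bilinear_map_linear(1)[OF act_bilinear] foldr_act_linear[OF uv(1)]]
    by simp
qed (use linear_mapD(1)[OF foldr_act_linear] assms in blast)

lemma tensor_act_tensor:
  "w \<in> lists (carrier G) \<Longrightarrow> a \<in> carrier A \<Longrightarrow> tensor_act (tensor G w) a = foldr act w a"
  by (rule tensor_lift_tensor[OF lie_module act_module foldr_act_multilinear])

lemma tensor_act_linear_left:
  "a \<in> carrier A \<Longrightarrow> linear_map (tensor_algebra G) A (\<lambda>z. tensor_act z a)"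
  by (rule tensor_lift_linear[OF lie_module act_module foldr_act_multilinear])

text \<open>For fixed \<open>a\<close> and \<open>b\<close> both sides of the claimed identities are linear in \<open>z\<close>, so \<open>z\<close> may be
  taken to be a pure tensor, which acts by a composition of linear maps.\<close>
lemma tensor_act_linear_right:
  assumes z: "z \<in> carrier (tensor_algebra G)"
  shows "linear_map A A (\<lambda>a. tensor_act z a)"
proof (rule linear_mapI)
  note ext = linear_map_ext_tensor[OF lie_module act_module _ _ _ z]
  note lin = tensor_act_linear_left
  fix a assume a: "a \<in> carrier A"
  then show "tensor_act z a \<in> carrier A" using linear_mapD(1)[OF lin] z by blast
  show "tensor_act z (c \<odot>\<^bsub>A\<^esub> a) = c \<odot>\<^bsub>A\<^esub> tensor_act z a" for c
    using a A.smult_closed linear_mapD(3)[OF foldr_act_linear]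
    by (intro ext[OF lin linear_map_scaled[OF act_module lin]]) (simp_all add: tensor_act_tensor)
  fix b assume b: "b \<in> carrier A"
  show "tensor_act z (a \<oplus>\<^bsub>A\<^esub> b) = tensor_act z a \<oplus>\<^bsub>A\<^esub> tensor_act z b"
    using a b linear_mapD(2)[OF foldr_act_linear]
    by (intro ext[OF lin linear_map_sum[OF act_module lin lin]]) (simp_all add: tensor_act_tensor)
qed

text \<open>Both sides are linear in \<open>z\<close> and \<open>z'\<close>, and for pure tensors the claim says that the action of a
  concatenation is the composition of the actions.\<close>
lemma tensor_act_mult:
  assumes z: "z \<in> carrier (tensor_algebra G)" and z': "z' \<in> carrier (tensor_algebra G)"
    and a: "a \<in> carrier A"
  shows "tensor_act (z \<otimes>\<^bsub>tensor_algebra G\<^esub> z') a = tensor_act z (tensor_act z' a)"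
proof -
  note lin = tensor_act_linear_left
  have right: "linear_map (tensor_algebra G) (tensor_algebra G) (\<lambda>y. y \<otimes>\<^bsub>tensor_algebra G\<^esub> y')"
    if "y' \<in> carrier (tensor_algebra G)" for y'
    using that by (intro linear_mapI) (simp_all add: T.l_distr T.smult_mult_left)
  have left: "linear_map (tensor_algebra G) (tensor_algebra G) (\<lambda>y. y' \<otimes>\<^bsub>tensor_algebra G\<^esub> y)"
    if "y' \<in> carrier (tensor_algebra G)" for y'
    using that by (intro linear_mapI) (simp_all add: T.r_distr T.smult_mult_right)
  have a': "tensor_act z' a \<in> carrier A" using linear_mapD(1)[OF lin] a z' by blast
  have "tensor_act (tensor G w \<otimes>\<^bsub>tensor_algebra G\<^esub> z') a = foldr act w (tensor_act z' a)"
    if w: "w \<in> lists (carrier G)" for w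
  proof (rule linear_map_ext_tensor[OF lie_module act_module
        linear_map_comp[OF left lin] linear_map_comp[OF lin foldr_act_linear] _ z'])
    fix w' assume w': "w' \<in> lists (carrier G)"
    show "tensor_act (tensor G w \<otimes>\<^bsub>tensor_algebra G\<^esub> tensor G w') a =
        foldr act w (tensor_act (tensor G w') a)"
      using w w' a by (simp add: tensor_append[OF lie_module, symmetric] tensor_act_tensor)
  qed (use w a in \<open>simp_all add: tensor_closed[OF lie_module]\<close>)
  then show ?thesis
    using a' a z' by (intro linear_map_ext_tensor[OF lie_module act_module
          linear_map_comp[OF right lin] lin _ z]) (simp_all add: tensor_act_tensor)
qed

text \<open>The annihilator of a module is a two-sided ideal because the action is multiplicative; it contains
  the defining relations of the enveloping algebra because the action respects the bracket.\<close>
lemma tensor_act_enveloping_ideal: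
  assumes z: "z \<in> enveloping_ideal G br" and a: "a \<in> carrier A"
  shows "tensor_act z a = \<zero>\<^bsub>A\<^esub>"
proof -
  let ?T = "tensor_algebra G"
  define K where "K = {z \<in> carrier ?T. \<forall>a\<in>carrier A. tensor_act z a = \<zero>\<^bsub>A\<^esub>}"
  note lin = tensor_act_linear_left
  have closed: "tensor_act z a \<in> carrier A" if "z \<in> carrier ?T" "a \<in> carrier A" for z a
    using linear_mapD(1)[OF lin] that by blast
  have "ideal K ?T"
  proof (rule T.idealI_closed)
    show "\<zero>\<^bsub>?T\<^esub> \<in> K"
      using linear_map_zero[OF T.module_axioms act_module lin] by (simp add: K_def)
    show "x \<oplus>\<^bsub>?T\<^esub> y \<in> K" if "x \<in> K" "y \<in> K" for x y
      using that linear_mapD(2)[OF lin] by (simp add: K_def)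
    show "x \<otimes>\<^bsub>?T\<^esub> y \<in> K" if "x \<in> carrier ?T" "y \<in> K" for x y
      using that linear_map_zero[OF act_module act_module tensor_act_linear_right]
      by (simp add: K_def tensor_act_mult)
    show "y \<otimes>\<^bsub>?T\<^esub> x \<in> K" if "x \<in> carrier ?T" "y \<in> K" for x y
      using that closed by (simp add: K_def tensor_act_mult)
  qed (auto simp: K_def)
  moreover have "enveloping_relations \<subseteq> K"
  proof (rule subsetI, elim CollectE exE conjE)
    fix z x y
    assume xy: "x \<in> carrier G" "y \<in> carrier G"
      and z: "z = tensor G [x, y] \<ominus>\<^bsub>?T\<^esub> tensor G [y, x] \<ominus>\<^bsub>?T\<^esub> tensor G [br x y]"
    have ts: "tensor G [x, y] \<in> carrier ?T" "tensor G [y, x] \<in> carrier ?T" "tensor G [br x y] \<in> carrier ?T"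
      using xy br_closed by (simp_all add: tensor_closed[OF lie_module])
    have "tensor_act z a = \<zero>\<^bsub>A\<^esub>" if a: "a \<in> carrier A" for a
    proof -
      have c: "act x (act y a) \<in> carrier A" "act y (act x a) \<in> carrier A"
        using xy a linear_mapD(1)[OF bilinear_map_linear(2)[OF act_bilinear]] by simp_all
      have b: "act (br x y) a = act x (act y a) \<ominus>\<^bsub>A\<^esub> act y (act x a)"
        using action xy a by (simp add: lie_action_def)
      have "tensor_act z a = act x (act y a) \<ominus>\<^bsub>A\<^esub> act y (act x a) \<ominus>\<^bsub>A\<^esub> act (br x y) a"
        using ts xy a br_closed unfolding z
        by (simp add: linear_map_minus[OF T.module_axioms act_module lin[OF a]] tensor_act_tensor)
      then show ?thesis using c by (simp add: b A.minus_eq A.r_neg)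
    qed
    then show "z \<in> K" using ts by (simp add: K_def z)
  qed
  ultimately have "enveloping_ideal G br \<subseteq> K"
    unfolding enveloping_ideal_def by (rule T.genideal_minimal)
  then show ?thesis using z a by (auto simp: K_def)
qed

lemma enveloping_act_coset:
  assumes z: "z \<in> carrier (tensor_algebra G)" and a: "a \<in> carrier A"
  shows "enveloping_act A act (enveloping_ideal G br +>\<^bsub>tensor_algebra G\<^esub> z) a = tensor_act z a"
  unfolding enveloping_act_def
  using T.quotient_representative[OF enveloping_ideal_ideal act_module
      tensor_act_linear_left[OF a] tensor_act_enveloping_ideal[OF _ a] z] .

lemma enveloping_act_linear_left:
  assumes a: "a \<in> carrier A"
  shows "linear_map (enveloping_algebra G br) A (\<lambda>u. enveloping_act A act u a)"
  unfolding enveloping_algebra_def enveloping_act_def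
  using T.linear_map_quotient[OF enveloping_ideal_ideal act_module
      tensor_act_linear_left[OF a] tensor_act_enveloping_ideal[OF _ a]] .

lemma enveloping_act_linear_right:
  assumes u: "u \<in> carrier (enveloping_algebra G br)"
  shows "linear_map A A (enveloping_act A act u)"
proof -
  obtain z where z: "z \<in> carrier (tensor_algebra G)" "u = enveloping_ideal G br +>\<^bsub>tensor_algebra G\<^esub> z"
    using u by (auto simp: enveloping_quotient)
  show ?thesis
    using linear_mapD[OF tensor_act_linear_right[OF z(1)]]
    by (intro linear_mapI) (simp_all add: z enveloping_act_coset A.smult_closed[simplified])
qed

text \<open>Equivariance of \<open>u \<mapsto> u \<rhd> a\<close> for left multiplication on the enveloping algebra.\<close>
lemma enveloping_act_incl_mult:
  assumes x: "x \<in> carrier G" and u: "u \<in> carrier (enveloping_algebra G br)" and a: "a \<in> carrier A"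
  shows "enveloping_act A act (enveloping_incl G br x \<otimes>\<^bsub>enveloping_algebra G br\<^esub> u) a =
    act x (enveloping_act A act u a)"
proof -
  obtain z where z: "z \<in> carrier (tensor_algebra G)" "u = enveloping_ideal G br +>\<^bsub>tensor_algebra G\<^esub> z"
    using u by (auto simp: enveloping_quotient)
  have "tensor_act z a \<in> carrier A" using linear_mapD(1)[OF tensor_act_linear_left] z a by blast
  then show ?thesis
    using x z a by (simp add: enveloping_incl_def enveloping_quotient tensor_closed[OF lie_module]
        enveloping_act_coset tensor_act_mult tensor_act_tensor)
qed

lemma enveloping_act_one:
  assumes a: "a \<in> carrier A"
  shows "enveloping_act A act \<one>\<^bsub>enveloping_algebra G br\<^esub> a = a"
proof -
  interpret F: unital_algebra "free_algebra (carrier G) :: ('r, 'g list \<Rightarrow>\<^sub>0 'r) module"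
    by (rule free_algebra_unital_algebra)
  have "\<one>\<^bsub>tensor_algebra G\<^esub> = tensor G []"
    unfolding tensor_algebra_def F.quotient_one by (simp add: tensor_def one_list)
  then have "\<one>\<^bsub>enveloping_algebra G br\<^esub> = enveloping_ideal G br +>\<^bsub>tensor_algebra G\<^esub> tensor G []"
    unfolding enveloping_algebra_def T.quotient_one by simp
  then show ?thesis
    using a by (simp add: enveloping_act_coset tensor_act_tensor tensor_closed[OF lie_module])
qed

end

end


section \<open>The action of a twist on a product\<close>

context
  fixes G :: "('r::comm_ring_1, 'g) module" and br :: "'g \<Rightarrow> 'g \<Rightarrow> 'g"
    and A :: "('r, 'a) module" and act :: "'g \<Rightarrow> 'a \<Rightarrow> 'a"
  assumes lie: "lie_algebra G br" and alg: "assoc_algebra A"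
    and action: "lie_action G br A act"
begin

interpretation U: unital_algebra "enveloping_algebra G br"
  by (rule enveloping_unital_algebra[OF lie])

lemma assoc_algebra_module: "module ground A"
  using alg by (simp add: assoc_algebra_def)

interpretation A: module ground A by (rule assoc_algebra_module)
interpretation TA: unital_algebra "tensor_algebra A"
  by (rule tensor_algebra_unital_algebra[OF assoc_algebra_module])

lemma mult_map_linear: "linear_map (tensor_algebra A) A (mult_map A)"
  and mult_map_tensor: "a \<in> carrier A \<Longrightarrow> b \<in> carrier A \<Longrightarrow> mult_map A (tensor A [a, b]) = a \<otimes>\<^bsub>A\<^esub> b"
proof -
  have ml: "multilinear A A (on_pairs A (monoid.mult A))"
    using alg by (intro on_pairs_multilinear A.module_axioms) (simp add: assoc_algebra_def)
  have eq: "mult_map A = tensor_lift A (on_pairs A (monoid.mult A))"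
    by (simp add: fun_eq_iff mult_map_def on_pairs_def[abs_def])
  show "linear_map (tensor_algebra A) A (mult_map A)"
    unfolding eq by (rule tensor_lift_linear[OF A.module_axioms A.module_axioms ml])
  show "mult_map A (tensor A [a, b]) = a \<otimes>\<^bsub>A\<^esub> b" if "a \<in> carrier A" "b \<in> carrier A"
    unfolding eq using that
    by (simp add: tensor_lift_tensor[OF A.module_axioms A.module_axioms ml]) (simp add: on_pairs_def)
qed

context
  fixes a b assumes a: "a \<in> carrier A" and b: "b \<in> carrier A"
begin

abbreviation (input) "acted_pair u v \<equiv>
  tensor A [enveloping_act A act u a, enveloping_act A act v b]"

lemma acted_pair_multilinear:
  "multilinear (enveloping_algebra G br) (tensor_algebra A) (on_pairs (tensor_algebra A) acted_pair)"
  by (intro on_pairs_multilinear TA.module_axioms bilinear_map_comp[OF tensor_bilinear]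
      enveloping_act_linear_left[OF lie action] A.module_axioms a b)

text \<open>
  The inner lift evaluates a word \<open>w\<close> over the enveloping algebra at \<open>a \<otimes> b\<close>. For \<open>w = [u, v]\<close> the
  function that it lifts is bilinear since \<open>u\<close> and \<open>v\<close> act linearly; for every other \<open>w\<close> it is 0.
\<close>
lemma enveloping_act2_inner:
  assumes "w \<in> lists (carrier (enveloping_algebra G br))"
  shows "tensor_lift (tensor_algebra A)
      (\<lambda>ab. case (w, ab) of
          ([u, v], [a, b]) \<Rightarrow> tensor A [enveloping_act A act u a, enveloping_act A act v b]
        | _ \<Rightarrow> \<zero>\<^bsub>tensor_algebra A\<^esub>) (tensor A [a, b]) =
    on_pairs (tensor_algebra A) acted_pair w"
proof -
  let ?h = "\<lambda>ab. case (w, ab) of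
      ([u, v], [a, b]) \<Rightarrow> tensor A [enveloping_act A act u a, enveloping_act A act v b]
    | _ \<Rightarrow> \<zero>\<^bsub>tensor_algebra A\<^esub>"
  have "multilinear A (tensor_algebra A) ?h"
  proof (cases "\<exists>u v. w = [u, v]")
    case True
    then obtain u v where w: "w = [u, v]" by blast
    have "?h = on_pairs (tensor_algebra A)
        (\<lambda>a b. tensor A [enveloping_act A act u a, enveloping_act A act v b])"
      by (simp add: w fun_eq_iff on_pairs_def split: list.split)
    moreover have "multilinear A (tensor_algebra A) (on_pairs (tensor_algebra A)
        (\<lambda>a b. tensor A [enveloping_act A act u a, enveloping_act A act v b]))"
      using assms w by (intro on_pairs_multilinear TA.module_axioms bilinear_map_comp[OF tensor_bilinear]
          enveloping_act_linear_right[OF lie action] A.module_axioms) simp_all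
    ultimately show ?thesis by simp
  next
    case False
    then have "?h = (\<lambda>ab. \<zero>\<^bsub>tensor_algebra A\<^esub>)"
      by (auto simp: fun_eq_iff split: list.split)
    then show ?thesis
      by (simp add: multilinear_def linear_map_const_zero[OF TA.module_axioms])
  qed
  then have "tensor_lift (tensor_algebra A) ?h (tensor A [a, b]) = ?h [a, b]"
    using a b by (intro tensor_lift_tensor[OF A.module_axioms TA.module_axioms]) simp_all
  then show ?thesis by (simp add: on_pairs_def split: list.split)
qed

lemma enveloping_act2_multilinear:
  "multilinear (enveloping_algebra G br) (tensor_algebra A)
    (\<lambda>w. tensor_lift (tensor_algebra A)
      (\<lambda>ab. case (w, ab) of
          ([u, v], [a, b]) \<Rightarrow> tensor A [enveloping_act A act u a, enveloping_act A act v b]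
        | _ \<Rightarrow> \<zero>\<^bsub>tensor_algebra A\<^esub>) (tensor A [a, b]))"
  using acted_pair_multilinear
  by (subst multilinear_cong[OF enveloping_act2_inner U.module_axioms])

text \<open>With \<open>twist_action_tensor\<close>, this determines the action of any twist, as a twist is a linear
  combination of pure tensors.\<close>
lemma twist_action_linear:
  "linear_map (tensor_algebra (enveloping_algebra G br)) A
    (\<lambda>F. mult_map A (enveloping_act2 A act F (tensor A [a, b])))"
  unfolding enveloping_act2_def
  by (rule linear_map_comp[OF tensor_lift_linear[OF U.module_axioms TA.module_axioms
        enveloping_act2_multilinear] mult_map_linear])

lemma twist_action_tensor:
  assumes u: "u \<in> carrier (enveloping_algebra G br)" and v: "v \<in> carrier (enveloping_algebra G br)"
  shows "mult_map A (enveloping_act2 A act (tensor (enveloping_algebra G br) [u, v]) (tensor A [a, b])) =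
    enveloping_act A act u a \<otimes>\<^bsub>A\<^esub> enveloping_act A act v b"
proof -
  have w: "[u, v] \<in> lists (carrier (enveloping_algebra G br))" using u v by simp
  have "enveloping_act2 A act (tensor (enveloping_algebra G br) [u, v]) (tensor A [a, b]) = acted_pair u v"
    unfolding enveloping_act2_def
      tensor_lift_tensor[OF U.module_axioms TA.module_axioms enveloping_act2_multilinear w]
      enveloping_act2_inner[OF w]
    by (simp add: on_pairs_def)
  then show ?thesis
    using linear_mapD(1)[OF enveloping_act_linear_left[OF lie action a] u]
      linear_mapD(1)[OF enveloping_act_linear_left[OF lie action b] v]
    by (simp add: mult_map_tensor)
qed

end

end


section \<open>The total degree filtration\<close>

(* Monomials are triples; quantifiers over them stay unsplit so that hypotheses about a monomial
   match. *)
declare split_paired_All [simp del] split_paired_Ex [simp del]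

fun total_degree :: "mono \<Rightarrow> nat" where
  "total_degree (m, M, I) = size M + 2 * m"

text \<open>The filtration of the Weyl algebra by total degree, with all antisymmetric degrees allowed.\<close>
definition order_ge :: "nat \<Rightarrow> (mono \<Rightarrow> 'r::comm_ring_1) \<Rightarrow> bool" where
  "order_ge p a \<longleftrightarrow> (\<forall>x. total_degree x < p \<longrightarrow> a x = 0)"

lemma order_geI: "(\<And>m M I. size M + 2 * m < p \<Longrightarrow> a (m, M, I) = 0) \<Longrightarrow> order_ge p a"
  by (simp add: order_ge_def split_paired_All)

lemma order_geD: "order_ge p a \<Longrightarrow> size M + 2 * m < p \<Longrightarrow> a (m, M, I) = 0"
  by (simp add: order_ge_def split_paired_All)

lemma order_ge_mono: "order_ge p a \<Longrightarrow> q \<le> p \<Longrightarrow> order_ge q a"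
  by (simp add: order_ge_def)

lemma order_ge_add: "order_ge p a \<Longrightarrow> order_ge p b \<Longrightarrow> order_ge p (\<lambda>x. a x + b x)"
  by (simp add: order_ge_def)

lemma order_ge_diff: "order_ge p a \<Longrightarrow> order_ge p b \<Longrightarrow> order_ge p (\<lambda>x. a x - b x)"
  by (simp add: order_ge_def)

lemma order_ge_scale: "order_ge p a \<Longrightarrow> order_ge p (\<lambda>x. c * a x)"
  by (simp add: order_ge_def)

lemma order_ge_sum: "(\<And>i. i \<in> I \<Longrightarrow> order_ge p (a i)) \<Longrightarrow> order_ge p (\<lambda>x. \<Sum>i\<in>I. a i x)"
  by (simp add: order_ge_def)

lemma order_ge_monom_w: "order_ge (total_degree Y) (monom_w Y)"
  by (auto simp: order_ge_def monom_w_def)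

lemma order_ge_ext_part: "order_ge p a \<Longrightarrow> order_ge p (ext_part k a)"
  by (intro order_geI) (simp add: ext_part_def order_geD)

text \<open>A monomial is split into two factors in every possible way, and total degrees add up. If the sum is
  below \<open>p + q\<close>, one of the factors lies below its bound.\<close>
lemma order_ge_w_mult:
  assumes a: "order_ge p a" and b: "order_ge q b"
  shows "order_ge (p + q) (w_mult a b)"
proof (rule order_geI)
  fix m and M :: "nat multiset" and I :: "nat set" assume lt: "size M + 2 * m < p + q"
  show "w_mult a b (m, M, I) = 0"
    unfolding w_mult_def prod.case wedge_def
  proof (intro sum.neutral ballI)
    fix k N J assume k: "k \<in> {..m}" and N: "N \<in> {N. N \<subseteq># M}"
    have "size M = size N + size (M - N)"
      using N by (metis mem_Collect_eq size_union subset_mset.add_diff_inverse)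
    then have "size N + 2 * k < p \<or> size (M - N) + 2 * (m - k) < q"
      using lt k by auto
    then show "wedge_sign J (I - J) * a (k, N, J) * b (m - k, M - N, I - J) = 0"
      using order_geD[OF a] order_geD[OF b] by auto
  qed
qed

lemma order_ge_sym_gen: "order_ge 1 (sym_gen i)"
  using order_ge_monom_w[of "(0, {#i#}, {})"] by (simp add: sym_gen_def)

lemma order_ge_ext_gen: "order_ge 0 (ext_gen i)"
  by (simp add: order_ge_def)

text \<open>The truncated difference is correct: order at least 0 holds for every element.\<close>
lemma order_ge_ins_sym: "order_ge p a \<Longrightarrow> order_ge (p - 1) (ins_sym i a)"
  by (intro order_geI) (simp add: ins_sym_def order_geD)

lemma order_ge_ins_ext: "order_ge p a \<Longrightarrow> order_ge p (ins_ext i a)"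
  by (intro order_geI) (simp add: ins_ext_def contract_def order_geD)

lemma order_ge_div_t: "order_ge p a \<Longrightarrow> order_ge (p - 2) (div_t a)"
  by (intro order_geI) (simp add: div_t_def order_geD)

context fedosov
begin

lemma order_ge_delta_inv:
  assumes "order_ge p a"
  shows "order_ge (p + 1) (delta_inv a)"
proof (rule order_geI)
  fix m and M :: "nat multiset" and I :: "nat set" assume lt: "size M + 2 * m < p + 1"
  have "order_ge (1 + p) (\<lambda>x. \<Sum>i<n. w_mult (sym_gen i) (ins_ext i a) x)"
    by (intro order_ge_sum order_ge_w_mult order_ge_sym_gen order_ge_ins_ext assms)
  then have "(\<Sum>i<n. w_mult (sym_gen i) (ins_ext i a) (m, M, I)) = 0"
    using lt by (intro order_geD) auto
  then show "delta_inv a (m, M, I) = 0" by (simp add: delta_inv_def)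
qed

lemma order_ge_mult_P_pow:
  "order_ge p a \<Longrightarrow> order_ge p' b \<Longrightarrow> order_ge (p + p' - 2 * q) (mult_P_pow q a b)"
proof (induction q arbitrary: p p' a b)
  case 0
  then show ?case using order_ge_w_mult[OF 0] by (simp add: order_ge_def)
next
  case (Suc q)
  have "order_ge ((p - 1) + (p' - 1) - 2 * q) (mult_P_pow q (ins_sym i a) (ins_sym j b))" for i j
    by (intro Suc.IH order_ge_ins_sym Suc.prems)
  then have "order_ge (p + p' - 2 * Suc q) (mult_P_pow q (ins_sym i a) (ins_sym j b))" for i j
    by (rule order_ge_mono) simp
  then have "order_ge (p + p' - 2 * Suc q)
      (\<lambda>x. \<Sum>i<n. \<Sum>j<n. (r i j + s i j) * mult_P_pow q (ins_sym i a) (ins_sym j b) x)"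
    by (intro order_ge_sum order_ge_scale)
  then show ?case by (simp add: order_ge_def)
qed

text \<open>Each contraction lowers the symmetric degree by 2, which the accompanying factor \<open>t\<close>, of degree 2,
  restores.\<close>
lemma order_ge_circ:
  assumes "order_ge p a" "order_ge p' b"
  shows "order_ge (p + p') (circ a b)"
proof (rule order_geI)
  fix m and M :: "nat multiset" and I :: "nat set" assume lt: "size M + 2 * m < p + p'"
  show "circ a b (m, M, I) = 0"
    unfolding circ_def prod.case
  proof (intro sum.neutral ballI)
    fix q assume q: "q \<in> {..m}"
    then have "mult_P_pow q a b (m - q, M, I) = 0"
      using lt by (intro order_geD[OF order_ge_mult_P_pow[OF assms]]) auto
    then show "\<iota> (1 / (2 ^ q * fact q)) * mult_P_pow q a b (m - q, M, I) = 0"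
      by simp
  qed
qed

lemma order_ge_ad:
  assumes a: "order_ge p a" and b: "order_ge p' b"
  shows "order_ge (p + p') (ad a b)"
proof -
  have 1: "order_ge (p + p') (circ (ext_part k a) (ext_part l b))" for k l
    by (intro order_ge_circ order_ge_ext_part a b)
  have 2: "order_ge (p + p') (circ (ext_part l b) (ext_part k a))" for k l
    using order_ge_circ[OF order_ge_ext_part[OF b] order_ge_ext_part[OF a]] by (simp add: add.commute)
  have "order_ge (p + p') (\<lambda>x. \<Sum>k\<le>n. \<Sum>l\<le>n.
     circ (ext_part k a) (ext_part l b) x - (- 1) ^ (k * l) * circ (ext_part l b) (ext_part k a) x)"
    by (intro order_ge_sum order_ge_diff order_ge_scale 1 2)
  then show ?thesis by (simp add: order_ge_def ad_def)
qed

text \<open>The degree condition is part of the characterisation of \<open>\<rho>\<close>, and the default value 0 satisfies it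
  as well.\<close>
lemma order_ge_rho: "order_ge 2 rho"
proof (cases "\<exists>!\<rho>. fedosov_equation \<rho>")
  case True
  then have "fedosov_equation rho"
    using theI'[OF True] by (simp add: rho_def)
  then have "rho \<in> w_filtered n 2 1"
    by (simp add: fedosov_equation_def)
  then show ?thesis
    unfolding w_filtered_def by (intro order_geI) (blast dest: leD)
next
  case False
  then show ?thesis by (simp add: rho_def order_ge_def)
qed

lemma order_ge_nabla_sym:
  assumes "order_ge p a"
  shows "order_ge p (nabla_sym i a)"
proof -
  have "order_ge p (w_mult (sym_gen j) (ins_sym k a))" for j k
    using order_ge_w_mult[OF order_ge_sym_gen order_ge_ins_sym[OF assms]]
    by (rule order_ge_mono) simp
  then have "order_ge p (\<lambda>x. \<Sum>j<n. \<Sum>k<n.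
      - dual_basis k (nabla (e i) (e j)) * w_mult (sym_gen j) (ins_sym k a) x)"
    by (intro order_ge_sum order_ge_scale)
  then show ?thesis by (simp add: order_ge_def nabla_sym_def)
qed

lemma order_ge_delta_CE:
  assumes "order_ge p a"
  shows "order_ge p (delta_CE a)"
proof (rule order_geI)
  fix m and M :: "nat multiset" and I :: "nat set" assume lt: "size M + 2 * m < p"
  have "ins_ext k a (m, M, J) = 0" for k J
    using lt by (intro order_geD[OF order_ge_ins_ext[OF assms]]) simp
  then show "delta_CE a (m, M, I) = 0" by (simp add: delta_CE_def)
qed

lemma order_ge_D:
  assumes "order_ge p a"
  shows "order_ge p (D a)"
proof -
  have "order_ge p (w_mult (ext_gen i) (nabla_sym i a))" for i
    using order_ge_w_mult[OF order_ge_ext_gen order_ge_nabla_sym[OF assms]] by simp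
  then have "order_ge p (\<lambda>x. (\<Sum>i<n. w_mult (ext_gen i) (nabla_sym i a) x) + delta_CE a x)"
    by (intro order_ge_add order_ge_sum order_ge_delta_CE assms)
  then show ?thesis by (simp add: order_ge_def D_def)
qed

definition raises_order :: "nat \<Rightarrow> ((mono \<Rightarrow> 'r) \<Rightarrow> mono \<Rightarrow> 'r) \<Rightarrow> bool" where
  "raises_order d P \<longleftrightarrow> (\<forall>Y. order_ge (total_degree Y + d) (P (monom_w Y)))"

lemma raises_order_delta_inv: "raises_order 1 delta_inv"
  using order_ge_delta_inv[OF order_ge_monom_w] by (simp add: raises_order_def)

lemma raises_order_D: "raises_order 0 D"
  using order_ge_D[OF order_ge_monom_w] by (simp add: raises_order_def)

lemma raises_order_ext_gen: "raises_order 0 (w_mult (ext_gen i))"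
  by (simp add: raises_order_def order_ge_w_mult[OF order_ge_ext_gen order_ge_monom_w, simplified])

text \<open>Here \<open>\<rho>\<close> having order at least 2 compensates for the division by \<open>t\<close>.\<close>
lemma raises_order_ad_rho: "raises_order 0 (\<lambda>b. div_t (ad rho b))"
  using order_ge_div_t[OF order_ge_ad[OF order_ge_rho order_ge_monom_w]] by (simp add: raises_order_def)

text \<open>The corresponding filtration for series with coefficients in a module. At \<open>p = 0\<close> it only says
  that the coefficients lie in the carrier.\<close>
definition vanishes_below :: "('r, 'a) module \<Rightarrow> nat \<Rightarrow> (mono \<Rightarrow> 'a) \<Rightarrow> bool" where
  "vanishes_below A p F \<longleftrightarrow>
     (\<forall>x. F x \<in> carrier A) \<and> (\<forall>x. total_degree x < p \<longrightarrow> F x = \<zero>\<^bsub>A\<^esub>)"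

text \<open>Below degree \<open>p + d\<close> each term of the sum is 0, since it has a coefficient of \<open>F\<close> below degree
  \<open>p\<close> as a factor. So the bound holds even where infinitely many monomials contribute.\<close>
lemma extend_op_vanishes_below:
  assumes A: "module ground A" and P: "raises_order d P" and F: "vanishes_below A p F"
  shows "vanishes_below A (p + d) (extend_op n A P F)"
proof -
  interpret A: module ground A by fact
  have "extend_op n A P F x = \<zero>\<^bsub>A\<^esub>" if x: "total_degree x < p + d" for x
    unfolding extend_op_def
  proof (rule A.add.finprod_one_eqI)
    fix Y assume "Y \<in> {Y. valid_mono n Y \<and> P (monom_w Y) x \<noteq> 0}"
    then have "total_degree Y + d \<le> total_degree x"
      using P by (auto simp: raises_order_def order_ge_def not_less[symmetric])
    then have "F Y = \<zero>\<^bsub>A\<^esub>"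
      using x F by (auto simp: vanishes_below_def)
    then show "P (monom_w Y) x \<odot>\<^bsub>A\<^esub> F Y = \<zero>\<^bsub>A\<^esub>" by (simp add: A.smult_r_null)
  qed
  moreover have "extend_op n A P F x \<in> carrier A" for x
    unfolding extend_op_def using F A.smult_closed
    by (intro A.finsum_closed) (auto simp: vanishes_below_def)
  ultimately show ?thesis by (simp add: vanishes_below_def)
qed

lemma vanishes_below_add:
  assumes A: "module ground A" and "vanishes_below A p F" "vanishes_below A p H"
  shows "vanishes_below A p (\<lambda>x. F x \<oplus>\<^bsub>A\<^esub> H x)"
proof -
  interpret A: module ground A by fact
  show ?thesis using assms(2,3) by (simp add: vanishes_below_def)
qed

text \<open>What the degree estimates require of an action of the basis vectors.\<close>
definition preserves_carrier :: "('r, 'a) module \<Rightarrow> ('g \<Rightarrow> 'a \<Rightarrow> 'a) \<Rightarrow> bool" where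
  "preserves_carrier A act \<longleftrightarrow> 
     (\<forall>i<n. (\<forall>a\<in>carrier A. act (e i) a \<in> carrier A) \<and> act (e i) \<zero>\<^bsub>A\<^esub> = \<zero>\<^bsub>A\<^esub>)"

lemma L_op_vanishes_below:
  assumes A: "module ground A" and act: "preserves_carrier A act" and F: "vanishes_below A p F"
  shows "vanishes_below A p (L_op A act F)"
proof -
  interpret A: module ground A by fact
  have "vanishes_below A p (\<lambda>Y. act (e i) (F Y))" if "i < n" for i
    using act F that by (auto simp: vanishes_below_def preserves_carrier_def)
  then have *: "vanishes_below A p (extend_op n A (w_mult (ext_gen i)) (\<lambda>Y. act (e i) (F Y)))" if "i < n" for i
    using extend_op_vanishes_below[OF A raises_order_ext_gen] that by fastforce
  show ?thesis
    unfolding vanishes_below_def L_op_def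
    using * by (auto simp: vanishes_below_def intro!: A.finsum_closed A.add.finprod_one_eqI)
qed

lemma fedosov_derivation_vanishes_below:
  assumes A: "module ground A" and act: "preserves_carrier A act" and F: "vanishes_below A p F"
  shows "vanishes_below A p (fedosov_derivation A act F)"
  unfolding fedosov_derivation_def
  using extend_op_vanishes_below[OF A raises_order_D F] extend_op_vanishes_below[OF A raises_order_ad_rho F]
  by (intro vanishes_below_add A L_op_vanishes_below act F) simp_all

text \<open>The derivation preserves the filtration and \<open>\<delta>\<^sup>-\<^sup>1\<close> raises it by 1; their anticommutator raises it
  by 1.\<close>
lemma tau_step_vanishes_below:
  assumes A: "module ground A" and act: "preserves_carrier A act" and F: "vanishes_below A p F"
  shows "vanishes_below A (Suc p) (tau_step A act F)"
  unfolding tau_step_def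
  using extend_op_vanishes_below[OF A raises_order_delta_inv]
  by (intro vanishes_below_add A fedosov_derivation_vanishes_below act) (simp_all add: F
      fedosov_derivation_vanishes_below[OF A act F] flip: Suc_eq_plus1)

lemma tau_step_power_vanishes_below:
  assumes A: "module ground A" and act: "preserves_carrier A act" and F: "\<And>x. F x \<in> carrier A"
  shows "vanishes_below A k ((tau_step A act ^^ k) F)"
proof (induction k)
  case 0
  then show ?case using F by (simp add: vanishes_below_def)
next
  case (Suc k)
  then show ?case using tau_step_vanishes_below[OF A act] by simp
qed

end


section \<open>Naturality of the Fedosov-Taylor series\<close>

context fedosov
begin

lemma tau_closed:
  assumes B: "module ground B" and actB: "preserves_carrier B actB" and b: "b \<in> carrier B"
  shows "tau B actB (const_series B b) x \<in> carrier B"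
proof -
  interpret B: module ground B by fact
  have "series_incl B (const_series B b) x \<in> carrier B" for x
    using b by (cases x) (simp add: series_incl_def const_series_def)
  then show ?thesis
    unfolding tau_def using tau_step_power_vanishes_below[OF B actB]
    by (intro B.finsum_closed) (simp add: vanishes_below_def)
qed

context
  fixes B :: "('r, 'b) module" and A :: "('r, 'a) module" and actB actA \<phi>
  assumes B: "module ground B" and A: "module ground A" and \<phi>: "linear_map B A \<phi>"
    and actB: "preserves_carrier B actB"
    and equivariant: "\<And>i b. i < n \<Longrightarrow> b \<in> carrier B \<Longrightarrow> \<phi> (actB (e i) b) = actA (e i) (\<phi> b)"
begin

interpretation B: module ground B by (rule B)
interpretation A: module ground A by (rule A)

lemma extend_op_natural:
  assumes F: "vanishes_below B 0 F"
  shows "\<phi> (extend_op n B P F x) = extend_op n A P (\<lambda>x. \<phi> (F x)) x"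
proof -
  have F: "F x \<in> carrier B" for x using F by (simp add: vanishes_below_def)
  show ?thesis
    unfolding extend_op_def using F linear_mapD(1,3)[OF \<phi>] A.smult_closed B.smult_closed
    by (subst linear_map_finsum[OF B A \<phi>]) (auto intro!: A.finsum_cong')
qed

lemma extend_op_closed:
  assumes F: "vanishes_below B 0 F"
  shows "vanishes_below B 0 (extend_op n B P F)"
  unfolding extend_op_def using F B.smult_closed
  by (auto simp: vanishes_below_def intro!: B.finsum_closed)

lemma L_op_natural:
  assumes F: "vanishes_below B 0 F"
  shows "\<phi> (L_op B actB F x) = L_op A actA (\<lambda>x. \<phi> (F x)) x"
proof -
  have F': "vanishes_below B 0 (\<lambda>Y. actB (e i) (F Y))" if "i < n" for i
    using F actB that by (simp add: vanishes_below_def preserves_carrier_def)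
  have "\<phi> (extend_op n B (w_mult (ext_gen i)) (\<lambda>Y. actB (e i) (F Y)) x) =
      extend_op n A (w_mult (ext_gen i)) (\<lambda>Y. actA (e i) (\<phi> (F Y))) x" if "i < n" for i
    using extend_op_natural[OF F'[OF that]] equivariant[OF that] F by (simp add: vanishes_below_def)
  moreover have "extend_op n B (w_mult (ext_gen i)) (\<lambda>Y. actB (e i) (F Y)) x \<in> carrier B" if "i < n" for i
    using extend_op_closed[OF F'[OF that]] by (simp add: vanishes_below_def)
  ultimately show ?thesis
    unfolding L_op_def using linear_mapD(1)[OF \<phi>]
    by (subst linear_map_finsum[OF B A \<phi>]) (auto intro!: A.finsum_cong', metis)
qed

lemma fedosov_derivation_natural:
  assumes F: "vanishes_below B 0 F"
  shows "\<phi> (fedosov_derivation B actB F x) = fedosov_derivation A actA (\<lambda>x. \<phi> (F x)) x"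
proof -
  have "extend_op n B P F x \<in> carrier B" "L_op B actB F x \<in> carrier B" for P
    using extend_op_closed[OF F] L_op_vanishes_below[OF B actB F] by (simp_all add: vanishes_below_def)
  then show ?thesis
    by (simp add: fedosov_derivation_def linear_mapD(2)[OF \<phi>] extend_op_natural[OF F] L_op_natural[OF F])
qed

lemma tau_step_natural:
  assumes F: "vanishes_below B 0 F"
  shows "\<phi> (tau_step B actB F x) = tau_step A actA (\<lambda>x. \<phi> (F x)) x"
proof -
  note 1 = fedosov_derivation_vanishes_below[OF B actB F]
  note 2 = extend_op_closed[OF F, of delta_inv]
  have "extend_op n B delta_inv (fedosov_derivation B actB F) x \<in> carrier B"
    "fedosov_derivation B actB (extend_op n B delta_inv F) x \<in> carrier B"
    using extend_op_closed[OF 1] fedosov_derivation_vanishes_below[OF B actB 2]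
    by (simp_all add: vanishes_below_def)
  then show ?thesis
    by (simp add: tau_step_def linear_mapD(2)[OF \<phi>] extend_op_natural[OF 1]
        fedosov_derivation_natural[OF F] fedosov_derivation_natural[OF 2] extend_op_natural[OF F])
qed

text \<open>
  The terms of the two series correspond under \<open>\<phi>\<close>. The coefficient at \<open>x\<close> sums the terms that do
  not vanish at \<open>x\<close>; on the side of \<open>B\<close> these are finitely many by the degree estimate, and on the
  side of \<open>A\<close> only terms that are 0 can be missing.
\<close>
lemma tau_natural:
  assumes b: "b \<in> carrier B"
  shows "\<phi> (tau B actB (const_series B b) x) = tau A actA (const_series A (\<phi> b)) x"
proof -
  define FB where "FB k = (tau_step B actB ^^ k) (series_incl B (const_series B b))" for k
  define FA where "FA k = (tau_step A actA ^^ k) (series_incl A (const_series A (\<phi> b)))" for k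
  have start: "series_incl B (const_series B b) x \<in> carrier B" for x
    using b by (cases x) (simp add: series_incl_def const_series_def)
  have below: "vanishes_below B k (FB k)" for k
    unfolding FB_def by (rule tau_step_power_vanishes_below[OF B actB start])
  then have closed: "FB k x \<in> carrier B" and vanish: "total_degree x < k \<Longrightarrow> FB k x = \<zero>\<^bsub>B\<^esub>" for k x
    by (auto simp: vanishes_below_def)
  then have closed0: "vanishes_below B 0 (FB k)" for k
    by (simp add: vanishes_below_def)
  note zero = linear_map_zero[OF B A \<phi>]
  have nat: "\<phi> (FB k x) = FA k x" for k x
  proof (induction k arbitrary: x)
    case 0
    show ?case
      by (cases x) (simp add: FA_def FB_def series_incl_def const_series_def zero)
  next
    case (Suc k)
    have "FA (Suc k) = tau_step A actA (\<lambda>x. \<phi> (FB k x))"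
      using Suc by (simp add: FA_def)
    moreover have "FB (Suc k) = tau_step B actB (FB k)"
      by (simp add: FB_def)
    ultimately show ?case using tau_step_natural[OF closed0] by simp
  qed
  have fin: "{k. FB k x \<noteq> \<zero>\<^bsub>B\<^esub>} \<subseteq> {..total_degree x}"
    using vanish[of x] by (auto simp: not_less[symmetric])
  have "\<phi> (tau B actB (const_series B b) x) = \<phi> (\<Oplus>\<^bsub>B\<^esub>k\<in>{k. FB k x \<noteq> \<zero>\<^bsub>B\<^esub>}. FB k x)"
    by (simp add: tau_def FB_def)
  also have "\<dots> = (\<Oplus>\<^bsub>A\<^esub>k\<in>{k. FB k x \<noteq> \<zero>\<^bsub>B\<^esub>}. \<phi> (FB k x))"
    by (rule linear_map_finsum[OF B A \<phi>]) (simp add: closed)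
  also have "\<dots> = (\<Oplus>\<^bsub>A\<^esub>k\<in>{k. FA k x \<noteq> \<zero>\<^bsub>A\<^esub>}. FA k x)"
  proof (rule A.add.finprod_mono_neutral_cong_left[symmetric])
    show "finite {k. FB k x \<noteq> \<zero>\<^bsub>B\<^esub>}" by (rule finite_subset[OF fin]) simp
    show "{k. FA k x \<noteq> \<zero>\<^bsub>A\<^esub>} \<subseteq> {k. FB k x \<noteq> \<zero>\<^bsub>B\<^esub>}"
      using zero by (auto simp flip: nat)
    show "(\<lambda>k. \<phi> (FB k x)) \<in> {k. FB k x \<noteq> \<zero>\<^bsub>B\<^esub>} \<rightarrow> carrier A"
      using closed linear_mapD(1)[OF \<phi>] by blast
  qed (simp_all add: nat)
  also have "\<dots> = tau A actA (const_series A (\<phi> b)) x"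
    by (simp add: tau_def FA_def)
  finally show ?thesis .
qed

end

context
  assumes lie: "lie_algebra G br" and e_closed: "\<And>i. i < n \<Longrightarrow> e i \<in> carrier G"
begin

abbreviation (input) "U \<equiv> enveloping_algebra G br"
abbreviation (input) "left_mult x u \<equiv> enveloping_incl G br x \<otimes>\<^bsub>U\<^esub> u"

text \<open>The series of the unit for left multiplication on the enveloping algebra; all other series that
  occur are images of it.\<close>
definition universal_tau :: "mono \<Rightarrow> ('g list \<Rightarrow>\<^sub>0 'r) set set" where
  "universal_tau = tau U left_mult (const_series U \<one>\<^bsub>U\<^esub>)"

interpretation U: unital_algebra U by (rule enveloping_unital_algebra[OF lie])
interpretation TU: unital_algebra "tensor_algebra U"
  by (rule tensor_algebra_unital_algebra[OF U.module_axioms])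

lemma left_mult_preserves_carrier: "preserves_carrier U left_mult"
  using enveloping_incl_closed[OF lie e_closed] by (simp add: preserves_carrier_def)

lemma universal_tau_closed: "universal_tau x \<in> carrier U"
  unfolding universal_tau_def
  by (rule tau_closed[OF U.module_axioms left_mult_preserves_carrier U.one_closed])

lemma tau_eq_act:
  assumes action: "lie_action G br A act" and a: "a \<in> carrier A"
  shows "tau A act (const_series A a) x = enveloping_act A act (universal_tau x) a"
  unfolding universal_tau_def
  using tau_natural[OF U.module_axioms act_module[OF lie action]
      enveloping_act_linear_left[OF lie action a] left_mult_preserves_carrier _ U.one_closed,
      of act x] e_closed
  by (simp add: enveloping_act_incl_mult[OF lie action] enveloping_act_one[OF lie action] a)

lemma tau_eq_tensor:
  "tau (tensor_algebra U) (tensor_enveloping_act G br)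
     (const_series (tensor_algebra U) (tensor U [\<one>\<^bsub>U\<^esub>])) x = tensor U [universal_tau x]"
  unfolding universal_tau_def
  using tau_natural[OF U.module_axioms TU.module_axioms
      tensor_linear[OF U.module_axioms] left_mult_preserves_carrier _ U.one_closed,
      of "tensor_enveloping_act G br" x] e_closed
  by (simp add: tensor_enveloping_act_tensor[OF lie])

text \<open>The scalar with which the product of the coefficients at the monomials \<open>fst p\<close> and \<open>snd p\<close> enters
  the coefficient of \<open>t\<^sup>m\<close> of a star product. It comes from the Weyl algebra alone.\<close>
definition coupling :: "nat \<Rightarrow> mono \<times> mono \<Rightarrow> 'r" where
  "coupling m p = circ (monom_w (fst p)) (monom_w (snd p)) (m, {#}, {})"

lemma m_pi_coupling:
  "sigma (m_pi A F H) m = (\<Oplus>\<^bsub>A\<^esub>p\<in>{p. valid_mono n (fst p) \<and> valid_mono n (snd p) \<and> coupling m p \<noteq> 0}.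
     coupling m p \<odot>\<^bsub>A\<^esub> (F (fst p) \<otimes>\<^bsub>A\<^esub> H (snd p)))"
  by (simp add: sigma_def m_pi_def coupling_def case_prod_unfold)

lemma twist_eq:
  "twist m = (\<Oplus>\<^bsub>tensor_algebra U\<^esub>p\<in>{p. valid_mono n (fst p) \<and> valid_mono n (snd p) \<and> coupling m p \<noteq> 0}.
     coupling m p \<odot>\<^bsub>tensor_algebra U\<^esub> tensor U [universal_tau (fst p), universal_tau (snd p)])"
  unfolding twist_def star_def Let_def m_pi_coupling tau_eq_tensor
  using tensor_append[OF U.module_axioms, of "[universal_tau y]" "[universal_tau z]" for y z]
  by (simp add: universal_tau_closed)

lemma twist_in_tensor_power: "twist m \<in> tensor_power U 2"
  unfolding twist_eq
  by (intro finsum_tensor_power smult_tensor_in_tensor_power U.module_axioms)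
     (simp_all add: universal_tau_closed)

text \<open>Acting with the twist on \<open>a \<otimes> b\<close> and multiplying is linear in the twist, and turns
  \<open>T Y \<otimes> T Z\<close> into the product of the coefficients of the two series at \<open>Y\<close> and \<open>Z\<close>.\<close>
lemma star_eq_twist_star:
  assumes alg: "assoc_algebra A" and action: "lie_action G br A act"
    and a: "a \<in> carrier A" and b: "b \<in> carrier A"
  shows "star A act (const_series A a) (const_series A b) m = twist_star A act twist a b m"
proof -
  let ?I = "{p. valid_mono n (fst p) \<and> valid_mono n (snd p) \<and> coupling m p \<noteq> 0}"
  let ?t = "\<lambda>p. tensor U [universal_tau (fst p), universal_tau (snd p)]"
  let ?f = "\<lambda>F. mult_map A (enveloping_act2 A act F (tensor A [a, b]))"
  note A = act_module[OF lie action]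
  interpret A: module ground A by (rule A)
  note f = twist_action_linear[OF lie alg action a b]
  have t: "?t p \<in> carrier (tensor_algebra U)" for p
    by (rule tensor_closed[OF U.module_axioms]) (simp add: universal_tau_closed)
  have ft: "?f (?t p) = enveloping_act A act (universal_tau (fst p)) a
      \<otimes>\<^bsub>A\<^esub> enveloping_act A act (universal_tau (snd p)) b" for p
    by (rule twist_action_tensor[OF lie alg action a b universal_tau_closed universal_tau_closed])
  have "twist_star A act twist a b m = (\<Oplus>\<^bsub>A\<^esub>p\<in>?I. ?f (coupling m p \<odot>\<^bsub>tensor_algebra U\<^esub> ?t p))"
    unfolding twist_star_def twist_eq
    by (rule linear_map_finsum[OF TU.module_axioms A f]) (simp add: t)
  also have "\<dots> = (\<Oplus>\<^bsub>A\<^esub>p\<in>?I. coupling m p \<odot>\<^bsub>A\<^esub> ?f (?t p))"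
    using linear_mapD(1)[OF f t] A.smult_closed
    by (intro A.finsum_cong') (auto simp: linear_mapD(3)[OF f t])
  also have "\<dots> = star A act (const_series A a) (const_series A b) m"
    by (simp add: star_def m_pi_coupling tau_eq_act[OF action] a b ft)
  finally show ?thesis by simp
qed

end

end

theorem proposition4p9:
  fixes \<iota> :: "rat \<Rightarrow> 'r::comm_ring_1"
    and G :: "('r, 'g) module" and br :: "'g \<Rightarrow> 'g \<Rightarrow> 'g"
    and n :: nat and e :: "nat \<Rightarrow> 'g"
    and nabla :: "'g \<Rightarrow> 'g \<Rightarrow> 'g"
    and r s :: "nat \<Rightarrow> nat \<Rightarrow> 'r"
    and Om :: "mono \<Rightarrow> 'r"
    and A :: "('r, 'a) module" and act :: "'g \<Rightarrow> 'a \<Rightarrow> 'a"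
    and a b :: 'a
  assumes "fedosov_data \<iota> G br n e nabla r s Om"
    and "assoc_algebra A"
    and "acts_by_derivations G br A act"
    and "a \<in> carrier A" and "b \<in> carrier A"
  shows "(\<forall>m. fedosov.twist \<iota> G br n e nabla r s Om m \<in> tensor_power (enveloping_algebra G br) 2) \<and>
    fedosov.star \<iota> G br n e nabla r s Om A act
      (const_series A a) (const_series A b) =
    twist_star A act (fedosov.twist \<iota> G br n e nabla r s Om) a b"
proof -
  interpret fedosov_data \<iota> G br n e nabla r s Om by fact
  have e: "e i \<in> carrier G" if "i < n" for i
    using basis that by (simp add: is_basis_def)
  have action: "lie_action G br A act"
    using assms(2,3) by (simp add: lie_action_def acts_by_derivations_def assoc_algebra_def)
  show ?thesis
    using twist_in_tensor_power[OF lie e] star_eq_twist_star[OF lie e assms(2) action assms(4,5)]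
    by (simp add: fun_eq_iff)
qed

end
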